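(* For $p\ge1$ let $\sigma_p$ be a locally moderate probability measure with compact support in $\mathbb C^{d_p}$. Then for every $\nu\ge1$ there exist constants $C_p>0$, $p\ge1$, such that $$\int_{\mathbb C^{d_p}}\big|\log|\langle a,u\rangle|\,\big|^\nu\,d\sigma_p(a)\le C_p\quad\text{for any } u\in\mathbb C^{d_p}\text{ with }\|u\|=1 .$$
   Context: $d_p\geq 1$ are integers (in the paper $\mathbb C^{d_p}\simeq H^0_{(2)}(X,L_p)$ is a Bergman space of dimension $d_p$), and $\langle a,u\rangle=\sum_ja_ju_j$. A positive measure $\sigma$ on a complex manifold $Y$ is called locally moderate if for any open set $U\subset Y$, any compact set $K\subset U$, and any compact family $\mathscr F$ of psh functions on $U$ (compact in $L^1_{loc}(U)$), there exist constants $c,\alpha>0$ such that $\int_Ke^{-\alpha\psi}\,d\sigma\le c$ for all $\psi\in\mathscr F$. *)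

theory Defs
  imports "HOL-Probability.Probability"
begin

text \<open>
  The dimension \<open>d p\<close> depends on the index \<open>p\<close>, so it has to be a term: \<open>\<complex>\<^sup>d\<close> is rendered as the set
  of functions \<open>nat \<Rightarrow> complex\<close> that are extensional on \<open>{..<d}\<close>.
\<close>

definition cspace :: "nat \<Rightarrow> (nat \<Rightarrow> complex) set" where
  "cspace d = {..<d} \<rightarrow>\<^sub>E UNIV"

definition ctop :: "nat \<Rightarrow> (nat \<Rightarrow> complex) topology" where
  "ctop d = product_topology (\<lambda>_. euclidean) {..<d}"

definition cborel :: "nat \<Rightarrow> (nat \<Rightarrow> complex) measure" where
  "cborel d = sigma (cspace d) {U. openin (ctop d) U}"

definition clebesgue :: "nat \<Rightarrow> (nat \<Rightarrow> complex) measure" where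
  "clebesgue d = PiM {..<d} (\<lambda>_. lborel)"

definition cnorm :: "nat \<Rightarrow> (nat \<Rightarrow> complex) \<Rightarrow> real" where
  "cnorm d u = L2_set (\<lambda>j. cmod (u j)) {..<d}"

definition cpairing :: "nat \<Rightarrow> (nat \<Rightarrow> complex) \<Rightarrow> (nat \<Rightarrow> complex) \<Rightarrow> complex" where
  "cpairing d a u = (\<Sum>j<d. a j * u j)"

definition cline :: "nat \<Rightarrow> (nat \<Rightarrow> complex) \<Rightarrow> (nat \<Rightarrow> complex) \<Rightarrow> complex \<Rightarrow> (nat \<Rightarrow> complex)" where
  "cline d a b z = (\<lambda>j\<in>{..<d}. a j + z * b j)"

text \<open>
  Extended-valued functions. \<open>log_ext\<close> and \<open>exp_ext\<close> follow the conventions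
  \<open>log 0 = -\<infinity>\<close>, \<open>exp (-\<infinity>) = 0\<close> and \<open>exp \<infinity> = \<infinity>\<close> (whereas \<open>ln 0 = 0\<close> in the library);
  \<open>powr_ext\<close> is only meant for positive exponents, so that \<open>\<infinity>\<close> is sent to \<open>\<infinity>\<close>.
\<close>

definition log_ext :: "real \<Rightarrow> ereal" where
  "log_ext x = (if x = 0 then - \<infinity> else ereal (ln x))"

definition exp_ext :: "ereal \<Rightarrow> ennreal" where
  "exp_ext x = (case x of ereal r \<Rightarrow> ennreal (exp r) | PInfty \<Rightarrow> \<infinity> | MInfty \<Rightarrow> 0)"

definition powr_ext :: "ereal \<Rightarrow> real \<Rightarrow> ennreal" where
  "powr_ext x \<nu> = (if x = \<infinity> then \<infinity> else ennreal (real_of_ereal x powr \<nu>))"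

text \<open>
  The Lebesgue integral with values in \<open>[-\<infinity>, \<infinity>)\<close> of a function whose positive part is integrable:
  \<open>e2ennreal\<close> sends negative numbers to \<open>0\<close>, so the two terms are the integrals of the positive and
  of the negative part.
\<close>

definition ext_integral :: "'a measure \<Rightarrow> ('a \<Rightarrow> ereal) \<Rightarrow> ereal" where
  "ext_integral M f =
     enn2ereal (\<integral>\<^sup>+x. e2ennreal (f x) \<partial>M) - enn2ereal (\<integral>\<^sup>+x. e2ennreal (- f x) \<partial>M)"

text \<open>
  Plurisubharmonic functions on an open set \<open>U\<close>: upper semicontinuous, with values in
  \<open>[-\<infinity>, \<infinity>)\<close>, and satisfying the sub-mean value inequality on every closed disc of a complex line
  that is contained in \<open>U\<close>. The constant \<open>-\<infinity>\<close> is not excluded here, but no function that is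
  \<open>-\<infinity>\<close> on a component of \<open>U\<close> belongs to \<open>L1loc d U\<close> below. Only the values on \<open>U\<close> matter.
\<close>

definition psh_on :: "nat \<Rightarrow> (nat \<Rightarrow> complex) set \<Rightarrow> ((nat \<Rightarrow> complex) \<Rightarrow> ereal) \<Rightarrow> bool" where
  "psh_on d U \<psi> \<longleftrightarrow>
     (\<forall>a\<in>U. \<psi> a < \<infinity>) \<and>
     (\<forall>c. openin (ctop d) {a \<in> U. \<psi> a < c}) \<and>
     (\<forall>a\<in>U. \<forall>b\<in>cspace d. (\<forall>z. cmod z \<le> 1 \<longrightarrow> cline d a b z \<in> U) \<longrightarrow>
        \<psi> a \<le> ext_integral (restrict_space lborel {0..1}) (\<lambda>t. \<psi> (cline d a b (cis (2 * pi * t)))))"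

text \<open>
  \<open>L\<^sup>1\<^sub>l\<^sub>o\<^sub>c(U)\<close>, with the topology defined by the seminorms \<open>f \<mapsto> \<integral>\<^sub>K \<bar>f\<bar>\<close>, \<open>K \<subseteq> U\<close> compact. Its elements
  are functions rather than classes modulo null sets; as the topology only sees the classes,
  compactness has the same meaning. Integrability makes the functions finite almost everywhere, so
  the value of \<open>\<infinity> - \<infinity>\<close> is irrelevant.
\<close>

definition L1loc :: "nat \<Rightarrow> (nat \<Rightarrow> complex) set \<Rightarrow> ((nat \<Rightarrow> complex) \<Rightarrow> ereal) set" where
  "L1loc d U = {f. f \<in> borel_measurable (restrict_space (clebesgue d) U) \<and>
     (\<forall>K. compactin (ctop d) K \<and> K \<subseteq> U \<longrightarrow> (\<integral>\<^sup>+x\<in>K. e2ennreal \<bar>f x\<bar> \<partial>clebesgue d) < \<infinity>)}"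

definition L1loc_topology ::
    "nat \<Rightarrow> (nat \<Rightarrow> complex) set \<Rightarrow> ((nat \<Rightarrow> complex) \<Rightarrow> ereal) topology" where
  "L1loc_topology d U = topology_generated_by
     {{g \<in> L1loc d U. (\<integral>\<^sup>+x\<in>K. e2ennreal \<bar>g x - f x\<bar> \<partial>clebesgue d) < ennreal \<epsilon>} | f K \<epsilon>.
        f \<in> L1loc d U \<and> compactin (ctop d) K \<and> K \<subseteq> U \<and> \<epsilon> > 0}"

definition locally_moderate :: "nat \<Rightarrow> (nat \<Rightarrow> complex) measure \<Rightarrow> bool" where
  "locally_moderate d \<sigma> \<longleftrightarrow> sets \<sigma> = sets (cborel d) \<and>
     (\<forall>U K F. openin (ctop d) U \<and> compactin (ctop d) K \<and> K \<subseteq> U \<and>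
        (\<forall>\<psi>\<in>F. psh_on d U \<psi>) \<and> compactin (L1loc_topology d U) F \<longrightarrow>
        (\<exists>c \<alpha>. c > 0 \<and> \<alpha> > 0 \<and>
           (\<forall>\<psi>\<in>F. (\<integral>\<^sup>+a\<in>K. exp_ext (- (ereal \<alpha> * \<psi> a)) \<partial>\<sigma>) \<le> ennreal c)))"

definition csupport :: "nat \<Rightarrow> (nat \<Rightarrow> complex) measure \<Rightarrow> (nat \<Rightarrow> complex) set" where
  "csupport d \<sigma> = {a \<in> cspace d. \<forall>V. openin (ctop d) V \<and> a \<in> V \<longrightarrow> emeasure \<sigma> V > 0}"

end

theory Submission
  imports Defs "HOL-Complex_Analysis.Cauchy_Integral_Formula"
begin

text \<open>
  The functions \<open>\<psi>\<^sub>u = log \<bar>\<langle>a, u\<rangle>\<bar>\<close> with \<open>\<parallel>u\<parallel> = 1\<close> form a compact family of psh functions on the whole space,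
  so local moderateness on the compact support gives \<open>\<integral> \<bar>\<langle>a, u\<rangle>\<bar>\<^sup>-\<^sup>\<alpha> d\<sigma> \<le> c\<close> uniformly in \<open>u\<close>, and
  \<open>x\<^sup>\<nu> \<le> (\<nu>/\<alpha>)\<^sup>\<nu> exp (\<alpha>x)\<close> bounds the moments of the logarithm. The family is compact because it is the
  image of the sphere under \<open>u \<mapsto> \<psi>\<^sub>u\<close>, which is continuous into \<open>L\<^sup>1\<^sub>l\<^sub>o\<^sub>c\<close>: the truncations
  \<open>max \<psi>\<^sub>u (-N)\<close> are Lipschitz in \<open>u\<close>, and the error of truncation is uniformly small since some
  coordinate of \<open>u\<close> is at least \<open>1/\<surd>d\<close>, so that \<open>{\<bar>\<langle>a, u\<rangle>\<bar> < s}\<close> has Lebesgue measure \<open>O(s\<^sup>2)\<close> on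
  polydiscs, by Fubini in that coordinate.
\<close>

section \<open>Topology and measurability of \<open>cspace\<close>\<close>

lemma topspace_ctop [simp]: "topspace (ctop d) = cspace d"
  by (simp add: ctop_def cspace_def)

lemma Hausdorff_ctop: "Hausdorff_space (ctop d)"
  unfolding ctop_def by (simp add: Hausdorff_space_product_topology)

text \<open>With restriction to \<open>{..<d}\<close> this embeds \<open>cspace d\<close> in the
  full type \<open>nat => complex\<close>, from whose topology continuity, measurability and the
  Lindelof property are carried over to \<open>ctop d\<close>.\<close>

definition zero_ext :: "nat \<Rightarrow> (nat \<Rightarrow> complex) \<Rightarrow> nat \<Rightarrow> complex" where
  "zero_ext d a = (\<lambda>i. if i < d then a i else 0)"

lemma restrict_zero_ext: "a \<in> cspace d \<Longrightarrow> restrict (zero_ext d a) {..<d} = a"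
  by (auto simp: zero_ext_def cspace_def PiE_def extensional_def restrict_def fun_eq_iff)

lemma continuous_map_zero_ext: "continuous_map (ctop d) euclidean (zero_ext d)"
  unfolding euclidean_product_topology[symmetric] continuous_map_componentwise_UNIV
proof
  fix i
  show "continuous_map (ctop d) euclidean (\<lambda>a. zero_ext d a i)"
    unfolding zero_ext_def ctop_def
    by (cases "i < d") (auto intro: continuous_map_product_projection)
qed

lemma continuous_map_restrict_ctop: "continuous_map euclidean (ctop d) (\<lambda>x. restrict x {..<d})"
  unfolding ctop_def continuous_map_componentwise by auto

lemma continuous_map_norm_cpairing:
  "continuous_map (ctop d) euclideanreal (\<lambda>a. cmod (cpairing d a u))"
proof -
  have "continuous_on UNIV (\<lambda>x::nat \<Rightarrow> complex. cmod (\<Sum>j<d. x j * u j))"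
    by (intro continuous_intros continuous_on_product_coordinates)
  then have "continuous_map (ctop d) euclideanreal ((\<lambda>x. cmod (\<Sum>j<d. x j * u j)) \<circ> zero_ext d)"
    by (intro continuous_map_compose[OF continuous_map_zero_ext]) simp
  then show ?thesis
    by (simp add: o_def zero_ext_def cpairing_def)
qed

lemma continuous_map_cnorm: "continuous_map (ctop d) euclideanreal (cnorm d)"
proof -
  have "continuous_on UNIV (\<lambda>x::nat \<Rightarrow> complex. sqrt (\<Sum>j<d. (cmod (x j))\<^sup>2))"
    by (intro continuous_intros continuous_on_product_coordinates)
  then have "continuous_map (ctop d) euclideanreal ((\<lambda>x. sqrt (\<Sum>j<d. (cmod (x j))\<^sup>2)) \<circ> zero_ext d)"
    by (intro continuous_map_compose[OF continuous_map_zero_ext]) simp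
  then show ?thesis
    by (simp add: o_def zero_ext_def cnorm_def[abs_def] L2_set_def)
qed

lemma space_clebesgue [simp]: "space (clebesgue d) = cspace d"
  by (simp add: clebesgue_def space_PiM cspace_def)

text \<open>\<open>V\<close> is the preimage under \<open>zero_ext d\<close> of an open set of the
  full function type, and \<open>zero_ext d\<close> is Borel measurable because its coordinates are.
  This places the open sets in the product sigma-algebra of \<open>clebesgue\<close>.\<close>

lemma openin_ctop_measurable:
  assumes "openin (ctop d) V"
  shows "V \<in> sets (clebesgue d)"
proof -
  have "(\<lambda>x. zero_ext d x i) \<in> borel_measurable (clebesgue d)" for i
    by (cases "i < d") (simp_all add: zero_ext_def clebesgue_def)
  then have "zero_ext d \<in> borel_measurable (clebesgue d)"
    using measurable_coordinatewise_then_product by blast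
  moreover have "open {x. restrict x {..<d} \<in> V}"
    using openin_continuous_map_preimage[OF continuous_map_restrict_ctop assms] by simp
  ultimately have "zero_ext d -` {x. restrict x {..<d} \<in> V} \<inter> space (clebesgue d) \<in> sets (clebesgue d)"
    using measurable_sets borel_open by metis
  also have "zero_ext d -` {x. restrict x {..<d} \<in> V} \<inter> space (clebesgue d) = V"
    using openin_subset[OF assms] by (auto simp: restrict_zero_ext)
  finally show ?thesis .
qed

lemma opens_subset_Pow: "{U. openin (ctop d) U} \<subseteq> Pow (cspace d)"
  using openin_subset by fastforce

lemma sets_cborel: "sets (cborel d) = sigma_sets (cspace d) {U. openin (ctop d) U}"
  unfolding cborel_def by (rule sets_measure_of[OF opens_subset_Pow])

lemma space_cborel [simp]: "space (cborel d) = cspace d"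
  unfolding cborel_def by (rule space_measure_of[OF opens_subset_Pow])

lemma sets_cborel_subset_clebesgue: "sets (cborel d) \<subseteq> sets (clebesgue d)"
  unfolding sets_cborel
  by (metis (mono_tags, lifting) sets.sigma_sets_subset space_clebesgue openin_ctop_measurable mem_Collect_eq subsetI)

lemma continuous_map_imp_cborel_measurable:
  fixes f :: "(nat \<Rightarrow> complex) \<Rightarrow> 'b::topological_space"
  assumes "continuous_map (ctop d) euclidean f"
  shows "f \<in> borel_measurable (cborel d)"
proof (rule borel_measurableI)
  fix S :: "'b set" assume "open S"
  then have "openin (ctop d) {x \<in> cspace d. f x \<in> S}"
    using openin_continuous_map_preimage[OF assms] by simp
  moreover have "f -` S \<inter> space (cborel d) = {x \<in> cspace d. f x \<in> S}"
    by auto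
  ultimately show "f -` S \<inter> space (cborel d) \<in> sets (cborel d)"
    unfolding sets_cborel by (simp add: sigma_sets.Basic)
qed

lemma closedin_ctop_cborel:
  assumes "closedin (ctop d) K"
  shows "K \<in> sets (cborel d)"
proof -
  have "cspace d - K \<in> sets (cborel d)"
    using assms by (auto simp: closedin_def sets_cborel intro: sigma_sets.Basic)
  then have "space (cborel d) - (cspace d - K) \<in> sets (cborel d)"
    by (rule sets.compl_sets)
  moreover have "cspace d - (cspace d - K) = K"
    using closedin_subset[OF assms] by auto
  ultimately show ?thesis by simp
qed

text \<open>The complement of the support is a union of open null sets. Lindelof's theorem, applied
  to their preimages under restriction, leaves a countable union, which is null.\<close>

lemma AE_in_csupport:
  assumes "sets \<sigma> = sets (cborel d)"
  shows "AE a in \<sigma>. a \<in> csupport d \<sigma>"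
proof -
  let ?r = "\<lambda>x::nat \<Rightarrow> complex. restrict x {..<d}"
  define \<V> where "\<V> = {V. openin (ctop d) V \<and> emeasure \<sigma> V = 0}"
  define \<W> where "\<W> = (\<lambda>V. ?r -` V) ` \<V>"
  have "open W" if "W \<in> \<W>" for W
    using that openin_continuous_map_preimage[OF continuous_map_restrict_ctop]
    by (auto simp: \<W>_def \<V>_def vimage_def)
  then obtain \<W>' where \<W>': "\<W>' \<subseteq> \<W>" "countable \<W>'" "\<Union>\<W>' = \<Union>\<W>"
    using Lindelof by metis
  then obtain \<V>' where \<V>': "\<V>' \<subseteq> \<V>" "countable \<V>'" "\<W>' = (\<lambda>V. ?r -` V) ` \<V>'"
    unfolding \<W>_def by (meson countable_subset_image)
  have "(\<Union>V\<in>\<V>'. V) \<in> null_sets \<sigma>"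
  proof (rule null_sets_UN'[OF \<V>'(2)])
    fix V assume "V \<in> \<V>'"
    then show "V \<in> null_sets \<sigma>"
      using \<V>'(1) assms by (auto simp: \<V>_def null_sets_def sets_cborel intro: sigma_sets.Basic)
  qed
  moreover have "{a \<in> space \<sigma>. a \<notin> csupport d \<sigma>} \<subseteq> (\<Union>V\<in>\<V>'. V)"
  proof
    fix a assume "a \<in> {a \<in> space \<sigma>. a \<notin> csupport d \<sigma>}"
    moreover have "space \<sigma> = cspace d"
      using sets_eq_imp_space_eq[OF assms] by simp
    ultimately obtain V where V: "a \<in> cspace d" "openin (ctop d) V" "a \<in> V" "emeasure \<sigma> V = 0"
      unfolding csupport_def mem_Collect_eq by (metis not_gr_zero)
    then have "V \<in> \<V>" "zero_ext d a \<in> ?r -` V"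
      by (simp_all add: \<V>_def restrict_zero_ext)
    then have "zero_ext d a \<in> \<Union>\<W>"
      unfolding \<W>_def by blast
    then have "zero_ext d a \<in> \<Union>((\<lambda>V. ?r -` V) ` \<V>')"
      using \<W>'(3) \<V>'(3) by simp
    then show "a \<in> (\<Union>V\<in>\<V>'. V)"
      using restrict_zero_ext[OF V(1)] by auto
  qed
  ultimately show ?thesis
    by (rule AE_I'[where N = "\<Union>V\<in>\<V>'. V"])
qed

section \<open>Integrability of \<open>log \<bar>\<langle>a, u\<rangle>\<bar>\<close> for Lebesgue measure\<close>

interpretation lborel_product: product_sigma_finite "\<lambda>_::nat. lborel :: complex measure"
  by standard

text \<open>Polydiscs rather than balls exhaust the space: being products, they have an explicit
  volume and are sliced easily by Fubini.\<close>

definition polydisc :: "nat \<Rightarrow> real \<Rightarrow> (nat \<Rightarrow> complex) set" where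
  "polydisc d R = {..<d} \<rightarrow>\<^sub>E cball 0 R"

lemma polydisc_subset: "polydisc d R \<subseteq> cspace d"
  by (auto simp: polydisc_def cspace_def)

lemma compactin_polydisc: "compactin (ctop d) (polydisc d R)"
  by (simp add: polydisc_def ctop_def compactin_PiE)

lemma polydisc_measurable: "polydisc d R \<in> sets (clebesgue d)"
  unfolding polydisc_def clebesgue_def by (intro sets_PiM_I_finite) auto

lemma compactin_imp_polydisc:
  assumes "compactin (ctop d) K"
  obtains R where "R \<ge> 0" "K \<subseteq> polydisc d R"
proof -
  have "\<forall>j\<in>{..<d}. \<exists>r. \<forall>a\<in>K. cmod (a j) \<le> r"
  proof
    fix j assume "j \<in> {..<d}"
    then have "continuous_map (ctop d) euclidean (\<lambda>a. a j)"
      unfolding ctop_def by (rule continuous_map_product_projection)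
    then have "compact ((\<lambda>a. a j) ` K)"
      using image_compactin[OF assms] by fastforce
    then show "\<exists>r. \<forall>a\<in>K. cmod (a j) \<le> r"
      using compact_imp_bounded bounded_iff by (metis imageI)
  qed
  then obtain r where r: "\<And>j a. j < d \<Longrightarrow> a \<in> K \<Longrightarrow> cmod (a j) \<le> r j"
    by (metis lessThan_iff)
  \<comment> \<open>A sum of absolute values dominates each bound and stays meaningful when
    \<open>d = 0\<close> or when \<open>K\<close> is empty and some \<open>r j\<close> is
    negative.\<close>
  define R where "R = (\<Sum>j<d. \<bar>r j\<bar>)"
  have "cmod (a j) \<le> R" if "j < d" "a \<in> K" for a j
  proof -
    have "cmod (a j) \<le> \<bar>r j\<bar>"
      using r[OF that] by linarith
    also have "\<dots> \<le> R"
      unfolding R_def using that by (intro member_le_sum) auto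
    finally show ?thesis .
  qed
  moreover have "K \<subseteq> cspace d"
    using compactin_subset_topspace[OF assms] by simp
  ultimately have "K \<subseteq> polydisc d R"
    by (fastforce simp: polydisc_def cspace_def PiE_iff)
  moreover have "R \<ge> 0"
    unfolding R_def by (intro sum_nonneg) auto
  ultimately show ?thesis
    using that by blast
qed

lemma emeasure_polydisc:
  assumes "R \<ge> 0"
  shows "emeasure (clebesgue d) (polydisc d R) = ennreal ((unit_ball_vol 2 * R\<^sup>2) ^ d)"
  unfolding polydisc_def clebesgue_def
  using assms by (subst lborel_product.emeasure_PiM) (simp_all add: emeasure_cball ennreal_power)

lemma norm_cpairing_measurable:
  "(\<lambda>a. cmod (cpairing d a u)) \<in> borel_measurable (clebesgue d)"
  unfolding cpairing_def clebesgue_def by measurable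

section \<open>Volume of the sublevel sets of a linear form\<close>

text \<open>Since \<open>w + z * c = c * (z + w / c)\<close>, the set lies in the disc of centre
  \<open>- w / c\<close> and radius \<open>s / m\<close>.\<close>

lemma emeasure_sublevel_affine:
  fixes w c :: complex
  assumes "m > 0" "m \<le> cmod c" "s > 0"
  shows "emeasure lborel {z. cmod (w + z * c) < s} \<le> ennreal (unit_ball_vol 2 * (s / m)\<^sup>2)"
proof -
  have "c \<noteq> 0"
    using assms by auto
  have "{z. cmod (w + z * c) < s} \<subseteq> ball (- w / c) (s / m)"
  proof
    fix z assume "z \<in> {z. cmod (w + z * c) < s}"
    moreover have "w + z * c = - ((- w / c - z) * c)"
      using \<open>c \<noteq> 0\<close> by (simp add: left_diff_distrib)
    ultimately have "cmod (- w / c - z) * cmod c < s"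
      by (simp del: minus_mult_left minus_diff_eq add: norm_mult)
    moreover have "cmod (- w / c - z) * m \<le> cmod (- w / c - z) * cmod c"
      using assms by (intro mult_left_mono) auto
    ultimately show "z \<in> ball (- w / c) (s / m)"
      using assms by (simp add: dist_norm field_simps)
  qed
  then have "emeasure lborel {z. cmod (w + z * c) < s} \<le> emeasure lborel (ball (- w / c) (s / m))"
    by (intro emeasure_mono) auto
  also have "\<dots> = ennreal (unit_ball_vol 2 * (s / m)\<^sup>2)"
    using assms by (subst emeasure_ball) auto
  finally show ?thesis .
qed

text \<open>Otherwise the \<open>d\<close> squares, each below \<open>1 / d\<close>, could not add
  up to 1.\<close>

lemma large_coordinate:
  assumes "cnorm d u = 1"
  obtains j where "j < d" "1 / sqrt d \<le> cmod (u j)"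
proof -
  have sum1: "(\<Sum>j<d. (cmod (u j))\<^sup>2) = 1"
    using assms by (simp add: cnorm_def L2_set_def)
  then have d: "d > 0"
    by (cases "d = 0") auto
  have "\<exists>j<d. 1 / sqrt d \<le> cmod (u j)"
  proof (rule ccontr)
    assume *: "\<not> ?thesis"
    have "(\<Sum>j<d. (cmod (u j))\<^sup>2) < (\<Sum>j<d. 1 / real d)"
    proof (rule sum_strict_mono)
      fix j assume "j \<in> {..<d}"
      then have "cmod (u j) < 1 / sqrt d"
        using * by auto
      then have "(cmod (u j))\<^sup>2 < (1 / sqrt d)\<^sup>2"
        by (intro power_strict_mono) auto
      then show "(cmod (u j))\<^sup>2 < 1 / real d"
        by (simp add: power_divide)
    qed (use d in auto)
    then show False
      using sum1 d by simp
  qed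
  then show ?thesis
    using that by blast
qed

text \<open>With the other coordinates frozen, the pairing is affine in a coordinate
  \<open>j\<close> whose slope \<open>u j\<close> is at least \<open>1 / sqrt d\<close>. Each slice
  has area at most a constant times \<open>s\<^sup>2\<close>, and Fubini multiplies this by the
  volume of the remaining polydisc.\<close>

lemma emeasure_sublevel_cpairing:
  assumes u: "cnorm d u = 1" and R: "R \<ge> 0" and s: "s > 0"
  shows "emeasure (clebesgue d) {a \<in> polydisc d R. cmod (cpairing d a u) < s}
    \<le> ennreal (real d * unit_ball_vol 2 * (unit_ball_vol 2 * R\<^sup>2) ^ (d - 1) * s\<^sup>2)"
proof -
  obtain j where j: "j < d" "1 / sqrt d \<le> cmod (u j)"
    using large_coordinate[OF u] .
  define I where "I = {..<d} - {j}"
  define P where "P = I \<rightarrow>\<^sub>E cball (0::complex) R"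
  define E where "E = {a \<in> polydisc d R. cmod (cpairing d a u) < s}"
  have I: "finite I" "j \<notin> I" "{..<d} = insert j I" "card I = d - 1"
    using j by (auto simp: I_def)
  have P: "P \<in> sets (PiM I (\<lambda>_. lborel))"
    unfolding P_def using I by (intro sets_PiM_I_finite) auto
  have E: "E \<in> sets (clebesgue d)"
  proof -
    have "{a \<in> space (clebesgue d). cmod (cpairing d a u) < s} \<in> sets (clebesgue d)"
      using norm_cpairing_measurable by measurable
    moreover have "E = {a \<in> space (clebesgue d). cmod (cpairing d a u) < s} \<inter> polydisc d R"
      using polydisc_subset by (auto simp: E_def)
    ultimately show ?thesis
      using polydisc_measurable by auto
  qed
  \<comment> \<open>The slice bound with \<open>m = 1 / sqrt d\<close>; this is the origin of the
    factor \<open>d\<close>.\<close>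
  define A where "A = unit_ball_vol 2 * (s / (1 / sqrt d))\<^sup>2"
  have A: "A = real d * unit_ball_vol 2 * s\<^sup>2" "A \<ge> 0"
    by (simp_all add: A_def power_mult_distrib)
  define w where "w = (\<lambda>x. \<Sum>k\<in>I. x k * u k)"
  \<comment> \<open>The constraint on coordinate \<open>j\<close> itself is dropped, so that the
    right-hand side is a product of a factor in \<open>x\<close> and a slice in
    \<open>y\<close>.\<close>
  have indicator_le: "indicator E (x(j := y)) \<le> (indicator P x * indicator {z. cmod (w x + z * u j) < s} y :: ennreal)"
    if "x \<in> space (PiM I (\<lambda>_. lborel))" for x y
  proof (cases "x(j := y) \<in> E")
    case True
    have "x \<in> extensional I"
      using that by (simp add: space_PiM PiE_def)
    moreover have "x k \<in> cball 0 R" if "k \<in> I" for k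
      using True that I unfolding E_def polydisc_def PiE_iff by (metis (no_types, lifting) fun_upd_other insertCI mem_Collect_eq)
    ultimately have "x \<in> P"
      by (auto simp: P_def PiE_iff)
    moreover have "cpairing d (x(j := y)) u = w x + y * u j"
    proof -
      have "(\<Sum>k\<in>I. (x(j := y)) k * u k) = w x"
        unfolding w_def using I by (intro sum.cong) auto
      then show ?thesis
        unfolding cpairing_def I(3) using I by simp
    qed
    ultimately show ?thesis
      using True by (simp add: E_def)
  qed simp
  have "emeasure (clebesgue d) E = (\<integral>\<^sup>+a. indicator E a \<partial>PiM (insert j I) (\<lambda>_. lborel))"
    using E by (simp add: clebesgue_def I)
  also have "\<dots> = (\<integral>\<^sup>+x. \<integral>\<^sup>+y. indicator E (x(j := y)) \<partial>lborel \<partial>PiM I (\<lambda>_. lborel))"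
    using E I by (intro lborel_product.product_nn_integral_insert) (auto simp: clebesgue_def)
  also have "\<dots> \<le> (\<integral>\<^sup>+x. ennreal A * indicator P x \<partial>PiM I (\<lambda>_. lborel))"
  proof (rule nn_integral_mono)
    fix x :: "nat \<Rightarrow> complex" assume x: "x \<in> space (PiM I (\<lambda>_. lborel))"
    have "(\<integral>\<^sup>+y. indicator E (x(j := y)) \<partial>lborel)
        \<le> (\<integral>\<^sup>+y. indicator P x * indicator {z. cmod (w x + z * u j) < s} y \<partial>lborel)"
      by (intro nn_integral_mono indicator_le x)
    also have "\<dots> = indicator P x * emeasure lborel {z. cmod (w x + z * u j) < s}"
      by (simp add: nn_integral_cmult)
    also have "\<dots> \<le> indicator P x * ennreal A"
      unfolding A_def using j s by (intro mult_left_mono emeasure_sublevel_affine) auto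
    finally show "(\<integral>\<^sup>+y. indicator E (x(j := y)) \<partial>lborel) \<le> ennreal A * indicator P x"
      by (simp add: mult.commute)
  qed
  also have "\<dots> = ennreal A * emeasure (PiM I (\<lambda>_. lborel)) P"
    using P by (simp add: nn_integral_cmult)
  also have "emeasure (PiM I (\<lambda>_. lborel)) P = ennreal ((unit_ball_vol 2 * R\<^sup>2) ^ (d - 1))"
    unfolding P_def using R I
    by (subst lborel_product.emeasure_PiM) (simp_all add: emeasure_cball ennreal_power)
  also have "ennreal A * \<dots> = ennreal (real d * unit_ball_vol 2 * (unit_ball_vol 2 * R\<^sup>2) ^ (d - 1) * s\<^sup>2)"
    using A by (simp flip: ennreal_mult add: mult_ac)
  finally show ?thesis
    by (simp add: E_def)
qed

section \<open>Truncations of the logarithm\<close>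

text \<open>This is the maximum of log t and -N, written so that it is real and meaningful at t =
  0.\<close>

definition trunc_log :: "nat \<Rightarrow> real \<Rightarrow> real" where
  "trunc_log N t = ln (max t (exp (- real N)))"

text \<open>The sum counts the \<open>k\<close> with \<open>k < - N - log t\<close>.\<close>

lemma log_ext_minus_trunc_log_le:
  assumes "t \<ge> 0"
  shows "e2ennreal \<bar>log_ext t - ereal (trunc_log N t)\<bar> \<le> (\<Sum>k. indicator {..<exp (- real (N + k))} t)"
proof -
  define g where "g = (\<lambda>k. indicator {..<exp (- real (N + k))} t :: ennreal)"
  have count: "of_nat n \<le> (\<Sum>k. g k)" if "\<And>k. k < n \<Longrightarrow> t < exp (- real (N + k))" for n
  proof -
    have "of_nat n = (\<Sum>k<n. g k)"
      using that by (simp add: g_def)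
    also have "\<dots> \<le> (\<Sum>k. g k)"
      by (intro sum_le_suminf) auto
    finally show ?thesis .
  qed
  consider "t = 0" | "t > 0" "t < exp (- real N)" | "t \<ge> exp (- real N)"
    using assms by linarith
  then have "e2ennreal \<bar>log_ext t - ereal (trunc_log N t)\<bar> \<le> (\<Sum>k. g k)"
  proof cases
    case 1
    \<comment> \<open>At t = 0 every indicator equals 1, so the series diverges and matches the
      infinite left-hand side.\<close>
    have "(SUP n. of_nat n) \<le> (\<Sum>k. g k)"
      using 1 by (intro SUP_least count) auto
    then show ?thesis
      by (simp add: ennreal_SUP_of_nat_eq_top top_unique)
  next
    case 2
    define x where "x = - real N - ln t"
    have "x > 0"
      using 2 ln_less_cancel_iff[of t "exp (- real N)"] by (simp add: x_def)
    have "e2ennreal \<bar>log_ext t - ereal (trunc_log N t)\<bar> = ennreal x"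
    proof -
      have "\<bar>log_ext t - ereal (trunc_log N t)\<bar> = ereal \<bar>ln t + real N\<bar>"
        using 2 by (simp add: log_ext_def trunc_log_def max_def)
      also have "\<bar>ln t + real N\<bar> = x"
        using \<open>x > 0\<close> by (simp add: x_def)
      finally show ?thesis
        by simp
    qed
    also have "\<dots> \<le> of_nat (nat \<lceil>x\<rceil>)"
      unfolding ennreal_of_nat_eq_real_of_nat by (intro ennreal_leI) linarith
    also have "\<dots> \<le> (\<Sum>k. g k)"
    proof (rule count)
      fix k assume "k < nat \<lceil>x\<rceil>"
      then have "real k < x"
        by linarith
      then have "ln t < - real (N + k)"
        by (simp add: x_def)
      then show "t < exp (- real (N + k))"
        using 2 by (metis exp_less_mono exp_ln)
    qed
    finally show ?thesis .
  next
    case 3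
    moreover have "t > 0"
      using 3 exp_gt_zero[of "- real N"] by linarith
    ultimately show ?thesis
      by (simp add: log_ext_def trunc_log_def max_def)
  qed
  then show ?thesis
    by (simp add: g_def)
qed

text \<open>On \<open>[exp (- N), \<infinity>)\<close> the derivative of \<open>ln\<close> is at
  most \<open>exp N\<close>, and the maximum with a constant does not increase distances.\<close>

lemma trunc_log_lipschitz: "\<bar>trunc_log N s - trunc_log N t\<bar> \<le> exp (real N) * \<bar>s - t\<bar>"
proof -
  have *: "ln x - ln y \<le> exp (real N) * (x - y)" if "exp (- real N) \<le> y" "y \<le> x" for x y :: real
  proof -
    have "y > 0"
      using that exp_gt_zero[of "- real N"] by linarith
    have "ln x - ln y \<le> (x - y) / y"
      using ln_diff_le[of x y] \<open>y > 0\<close> that by linarith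
    also have "\<dots> \<le> (x - y) / exp (- real N)"
      using that \<open>y > 0\<close> by (intro divide_left_mono) auto
    finally show ?thesis
      by (simp add: exp_minus field_simps)
  qed
  let ?m = "\<lambda>t. max t (exp (- real N))"
  have "\<bar>ln (?m s) - ln (?m t)\<bar> \<le> exp (real N) * \<bar>?m s - ?m t\<bar>"
  proof (cases "?m s \<le> ?m t")
    case True
    then show ?thesis
      using *[of "?m s" "?m t"] by (smt (verit) exp_gt_zero ln_le_cancel_iff max.cobounded2)
  next
    case False
    then show ?thesis
      using *[of "?m t" "?m s"] by (smt (verit) exp_gt_zero ln_le_cancel_iff max.cobounded2)
  qed
  also have "\<dots> \<le> exp (real N) * \<bar>s - t\<bar>"
    by (intro mult_left_mono) auto
  finally show ?thesis
    by (simp add: trunc_log_def)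
qed

definition log_pairing :: "nat \<Rightarrow> (nat \<Rightarrow> complex) \<Rightarrow> (nat \<Rightarrow> complex) \<Rightarrow> ereal" where
  "log_pairing d u a = log_ext (cmod (cpairing d a u))"

lemma log_ext_measurable [measurable]: "log_ext \<in> borel_measurable borel"
  unfolding log_ext_def[abs_def] by measurable

lemma trunc_log_measurable [measurable]: "trunc_log N \<in> borel_measurable borel"
  unfolding trunc_log_def[abs_def] by measurable

lemma log_pairing_measurable [measurable]: "log_pairing d u \<in> borel_measurable (clebesgue d)"
  unfolding log_pairing_def[abs_def] using norm_cpairing_measurable by measurable

text \<open>The factor of \<open>s\<^sup>2\<close> in \<open>emeasure_sublevel_cpairing\<close>; it
  does not depend on \<open>u\<close>.\<close>

definition sublevel_const :: "nat \<Rightarrow> real \<Rightarrow> real" where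
  "sublevel_const d R = real d * unit_ball_vol 2 * (unit_ball_vol 2 * R\<^sup>2) ^ (d - 1)"

lemma sublevel_const_nonneg: "sublevel_const d R \<ge> 0"
  by (simp add: sublevel_const_def)

text \<open>A layer-cake argument: integrating the series of indicators termwise gives the volumes
  of the sublevel sets at heights \<open>exp (- (N + k))\<close>, which decay geometrically in
  \<open>k\<close>. The bound is uniform in \<open>u\<close>.\<close>

lemma nn_integral_log_minus_trunc_log:
  assumes u: "cnorm d u = 1" and R: "R \<ge> 0"
  shows "(\<integral>\<^sup>+a\<in>polydisc d R. e2ennreal \<bar>log_pairing d u a - ereal (trunc_log N (cmod (cpairing d a u)))\<bar> \<partial>clebesgue d)
    \<le> ennreal (2 * sublevel_const d R * exp (- real N))"
proof -
  note [measurable] = norm_cpairing_measurable polydisc_measurable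
  let ?h = "\<lambda>a. cmod (cpairing d a u)"
  have h_level: "{a \<in> space (clebesgue d). ?h a < s} \<in> sets (clebesgue d)" for s
    using norm_cpairing_measurable by measurable
  have *: "(\<integral>\<^sup>+a\<in>polydisc d R. indicator {..<exp (- real (N + k))} (?h a) \<partial>clebesgue d)
      \<le> ennreal (sublevel_const d R * exp (- real N) * (1 / 2) ^ k)" for k
  proof -
    let ?s = "exp (- real (N + k))"
    have "(\<integral>\<^sup>+a\<in>polydisc d R. indicator {..<?s} (?h a) \<partial>clebesgue d)
        = (\<integral>\<^sup>+a. indicator {a \<in> polydisc d R. ?h a < ?s} a \<partial>clebesgue d)"
      by (intro nn_integral_cong) (auto simp: indicator_def)
    also have "\<dots> = emeasure (clebesgue d) {a \<in> polydisc d R. ?h a < ?s}"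
    proof (rule nn_integral_indicator)
      have "{a \<in> polydisc d R. ?h a < ?s} = {a \<in> space (clebesgue d). ?h a < ?s} \<inter> polydisc d R"
        using polydisc_subset by auto
      then show "{a \<in> polydisc d R. ?h a < ?s} \<in> sets (clebesgue d)"
        using sets.Int[OF h_level[of ?s] polydisc_measurable] by (simp only:)
    qed
    also have "\<dots> \<le> ennreal (sublevel_const d R * ?s\<^sup>2)"
      unfolding sublevel_const_def by (intro emeasure_sublevel_cpairing u R) simp
    \<comment> \<open>The decay is weakened through \<open>s\<^sup>2 \<le> s\<close> for
      \<open>s \<le> 1\<close> and \<open>exp (- 1) \<le> 1 / 2\<close>, which leaves a geometric
      series of sum 2.\<close>
    also have "\<dots> \<le> ennreal (sublevel_const d R * (exp (- real N) * (1 / 2) ^ k))"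
    proof (intro ennreal_leI mult_left_mono sublevel_const_nonneg)
      have "exp (- real k) \<le> (1 / 2) ^ k"
      proof -
        have "exp (- 1) \<le> (1 / 2 :: real)"
          using exp_ge_add_one_self[of 1] by (simp add: exp_minus field_simps)
        then have "exp (- 1) ^ k \<le> (1 / 2 :: real) ^ k"
          by (intro power_mono) auto
        then show ?thesis
          by (simp flip: exp_of_nat_mult)
      qed
      then have "exp (- real N) * exp (- real k) \<le> exp (- real N) * (1 / 2) ^ k"
        by (intro mult_left_mono) auto
      then have "?s \<le> exp (- real N) * (1 / 2) ^ k"
        by (simp add: exp_add[symmetric])
      moreover have "?s\<^sup>2 \<le> ?s"
        by (simp add: power2_eq_square mult_le_cancel_left1)
      ultimately show "?s\<^sup>2 \<le> exp (- real N) * (1 / 2) ^ k"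
        by linarith
    qed
    finally show ?thesis
      by (simp add: mult.assoc)
  qed
  have "(\<integral>\<^sup>+a\<in>polydisc d R. e2ennreal \<bar>log_pairing d u a - ereal (trunc_log N (?h a))\<bar> \<partial>clebesgue d)
      \<le> (\<integral>\<^sup>+a\<in>polydisc d R. (\<Sum>k. indicator {..<exp (- real (N + k))} (?h a)) \<partial>clebesgue d)"
    unfolding log_pairing_def
    by (intro nn_integral_mono mult_right_mono log_ext_minus_trunc_log_le) auto
  also have "\<dots> = (\<integral>\<^sup>+a. (\<Sum>k. indicator {..<exp (- real (N + k))} (?h a) * indicator (polydisc d R) a) \<partial>clebesgue d)"
    by (intro nn_integral_cong) simp
  also have "\<dots> = (\<Sum>k. \<integral>\<^sup>+a\<in>polydisc d R. indicator {..<exp (- real (N + k))} (?h a) \<partial>clebesgue d)"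
    by (intro nn_integral_suminf) measurable
  also have "\<dots> \<le> (\<Sum>k. ennreal (sublevel_const d R * exp (- real N) * (1 / 2) ^ k))"
    by (intro suminf_le * ) auto
  also have "\<dots> = ennreal (\<Sum>k. sublevel_const d R * exp (- real N) * (1 / 2) ^ k)"
    using sublevel_const_nonneg by (intro suminf_ennreal2 summable_mult summable_geometric) auto
  also have "(\<Sum>k. sublevel_const d R * exp (- real N) * (1 / 2) ^ k) = 2 * sublevel_const d R * exp (- real N)"
    by (subst suminf_mult) (auto simp: suminf_geometric summable_geometric)
  finally show ?thesis .
qed

text \<open>No finiteness is needed, because \<open>\<infinity> - \<infinity> = \<infinity>\<close> in \<open>ereal\<close>.\<close>

lemma ereal_abs_diff_triangle: "\<bar>x - z\<bar> \<le> \<bar>x - y\<bar> + \<bar>y - z :: ereal\<bar>"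
  by (cases x; cases y; cases z) auto

lemma ereal_abs_diff_commute: "\<bar>x - y\<bar> = \<bar>y - x :: ereal\<bar>"
  by (cases x; cases y) auto

lemma e2ennreal_add: "x \<ge> 0 \<Longrightarrow> y \<ge> 0 \<Longrightarrow> e2ennreal (x + y) = e2ennreal x + e2ennreal y"
  by (cases x; cases y) simp_all

lemma e2ennreal_triangle: "e2ennreal \<bar>x - z\<bar> \<le> e2ennreal \<bar>x - y\<bar> + e2ennreal \<bar>y - z\<bar>"
proof -
  have "e2ennreal \<bar>x - z\<bar> \<le> e2ennreal (\<bar>x - y\<bar> + \<bar>y - z\<bar>)"
    by (intro e2ennreal_mono ereal_abs_diff_triangle)
  also have "\<dots> = e2ennreal \<bar>x - y\<bar> + e2ennreal \<bar>y - z\<bar>"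
    by (rule e2ennreal_add) auto
  finally show ?thesis .
qed

lemma nn_integral_abs_diff_triangle:
  assumes [measurable]: "f \<in> borel_measurable M" "g \<in> borel_measurable M" "h \<in> borel_measurable M"
    "K \<in> sets M"
  shows "(\<integral>\<^sup>+a\<in>K. e2ennreal \<bar>f a - h a\<bar> \<partial>M)
    \<le> (\<integral>\<^sup>+a\<in>K. e2ennreal \<bar>f a - g a\<bar> \<partial>M) + (\<integral>\<^sup>+a\<in>K. e2ennreal \<bar>g a - h a\<bar> \<partial>M)"
proof -
  have "(\<integral>\<^sup>+a\<in>K. e2ennreal \<bar>f a - h a\<bar> \<partial>M)
      \<le> (\<integral>\<^sup>+a. e2ennreal \<bar>f a - g a\<bar> * indicator K a + e2ennreal \<bar>g a - h a\<bar> * indicator K a \<partial>M)"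
    by (intro nn_integral_mono) (simp add: e2ennreal_triangle indicator_def)
  also have "\<dots> = (\<integral>\<^sup>+a\<in>K. e2ennreal \<bar>f a - g a\<bar> \<partial>M) + (\<integral>\<^sup>+a\<in>K. e2ennreal \<bar>g a - h a\<bar> \<partial>M)"
    by (intro nn_integral_add) measurable
  finally show ?thesis .
qed

lemma nn_integral_polydisc_bounded:
  assumes "R \<ge> 0" "\<And>a. a \<in> polydisc d R \<Longrightarrow> f a \<le> ennreal B"
  shows "(\<integral>\<^sup>+a\<in>polydisc d R. f a \<partial>clebesgue d) \<le> ennreal B * ennreal ((unit_ball_vol 2 * R\<^sup>2) ^ d)"
proof -
  have "(\<integral>\<^sup>+a\<in>polydisc d R. f a \<partial>clebesgue d) \<le> (\<integral>\<^sup>+a\<in>polydisc d R. ennreal B \<partial>clebesgue d)"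
    using assms(2) by (intro nn_integral_mono) (simp add: indicator_def)
  also have "\<dots> = ennreal B * ennreal ((unit_ball_vol 2 * R\<^sup>2) ^ d)"
    using assms(1) by (simp add: nn_integral_cmult_indicator polydisc_measurable emeasure_polydisc)
  finally show ?thesis .
qed

text \<open>The coordinatewise bound \<open>r\<close> serves both unit vectors, with
  \<open>r = 1\<close>, and small differences of two of them.\<close>

lemma norm_cpairing_polydisc:
  assumes "a \<in> polydisc d R" "\<And>j. j < d \<Longrightarrow> cmod (u j) \<le> r"
  shows "cmod (cpairing d a u) \<le> real d * (R * r)"
proof -
  have "cmod (cpairing d a u) \<le> (\<Sum>j<d. cmod (a j) * cmod (u j))"
    unfolding cpairing_def norm_mult[symmetric] by (rule norm_sum)
  also have "\<dots> \<le> (\<Sum>j<d. R * r)"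
  proof (intro sum_mono mult_mono)
    fix j assume "j \<in> {..<d}"
    then show "cmod (a j) \<le> R" "cmod (u j) \<le> r"
      using assms by (auto simp: polydisc_def PiE_iff)
    then show "0 \<le> R"
      using norm_ge_zero order_trans by blast
  qed auto
  finally show ?thesis by simp
qed

lemma cnorm_component_le:
  assumes "j < d"
  shows "cmod (u j) \<le> cnorm d u"
  unfolding cnorm_def using assms by (intro member_le_L2_set) auto

text \<open>Comparison with the truncation at level \<open>N = 0\<close>: the error is integrable by
  the previous estimate, and the truncation, being 1-Lipschitz and zero at 0, is bounded on
  polydiscs.\<close>

lemma log_pairing_L1loc:
  assumes u: "cnorm d u = 1"
  shows "log_pairing d u \<in> L1loc d (cspace d)"
  unfolding L1loc_def
proof (intro CollectI conjI allI impI)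
  show "log_pairing d u \<in> borel_measurable (restrict_space (clebesgue d) (cspace d))"
    by (intro measurable_restrict_space1 log_pairing_measurable)
next
  fix K assume K: "compactin (ctop d) K \<and> K \<subseteq> cspace d"
  obtain R where R: "R \<ge> 0" "K \<subseteq> polydisc d R"
    using compactin_imp_polydisc K by blast
  note [measurable] = norm_cpairing_measurable polydisc_measurable
  let ?T = "\<lambda>a. trunc_log 0 (cmod (cpairing d a u))"
  have T: "e2ennreal \<bar>ereal (?T a) - 0\<bar> \<le> ennreal (real d * R)" if "a \<in> polydisc d R" for a
  proof -
    have "cmod (cpairing d a u) \<le> real d * (R * 1)"
      using that u cnorm_component_le by (intro norm_cpairing_polydisc) metis+
    then have "\<bar>?T a\<bar> \<le> real d * R"
      using trunc_log_lipschitz[of 0 "cmod (cpairing d a u)" 0] by (simp add: trunc_log_def)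
    then show ?thesis
      by (simp add: ennreal_leI)
  qed
  have "(\<integral>\<^sup>+a\<in>K. e2ennreal \<bar>log_pairing d u a\<bar> \<partial>clebesgue d)
      \<le> (\<integral>\<^sup>+a\<in>polydisc d R. e2ennreal \<bar>log_pairing d u a - 0\<bar> \<partial>clebesgue d)"
    using R by (intro nn_integral_mono) (auto simp: indicator_def)
  also have "\<dots> \<le> (\<integral>\<^sup>+a\<in>polydisc d R. e2ennreal \<bar>log_pairing d u a - ereal (?T a)\<bar> \<partial>clebesgue d)
      + (\<integral>\<^sup>+a\<in>polydisc d R. e2ennreal \<bar>ereal (?T a) - 0\<bar> \<partial>clebesgue d)"
    by (intro nn_integral_abs_diff_triangle) measurable
  also have "\<dots> \<le> ennreal (2 * sublevel_const d R * exp (- real 0))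
      + ennreal (real d * R) * ennreal ((unit_ball_vol 2 * R\<^sup>2) ^ d)"
    using R T by (intro add_mono nn_integral_log_minus_trunc_log u nn_integral_polydisc_bounded)
  also have "\<dots> < \<infinity>"
    by (simp add: ennreal_mult_less_top)
  finally show "(\<integral>\<^sup>+a\<in>K. e2ennreal \<bar>log_pairing d u a\<bar> \<partial>clebesgue d) < \<infinity>" .
qed

text \<open>Both logarithms are replaced by their truncations at a common level. The two truncation
  errors cost \<open>\<epsilon> / 4\<close> each, and the Lipschitz bound between the truncations
  costs \<open>\<epsilon> / 2\<close>.\<close>

lemma log_pairing_L1_uniformly_continuous:
  assumes R: "R \<ge> 0" and "\<epsilon> > 0"
  obtains \<delta> where "\<delta> > 0"
    "\<And>u v. cnorm d u = 1 \<Longrightarrow> cnorm d v = 1 \<Longrightarrow> (\<And>j. j < d \<Longrightarrow> cmod (u j - v j) \<le> \<delta>) \<Longrightarrow>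
      (\<integral>\<^sup>+a\<in>polydisc d R. e2ennreal \<bar>log_pairing d u a - log_pairing d v a\<bar> \<partial>clebesgue d) \<le> ennreal \<epsilon>"
proof -
  define M where "M = 2 * sublevel_const d R"
  have M: "M \<ge> 0"
    using sublevel_const_nonneg by (simp add: M_def)
  define V where "V = (unit_ball_vol 2 * R\<^sup>2) ^ d"
  have V: "V \<ge> 0"
    by (simp add: V_def)
  have "((\<lambda>N. M * exp (- real N)) \<longlongrightarrow> M * 0) sequentially"
    by (intro tendsto_mult tendsto_const filterlim_compose[OF exp_at_bot]
        filterlim_compose[OF filterlim_uminus_at_bot_at_top filterlim_real_sequentially])
  then have "eventually (\<lambda>N. M * exp (- real N) < \<epsilon> / 4) sequentially"
    using \<open>\<epsilon> > 0\<close> by (intro order_tendstoD) auto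
  \<comment> \<open>The level is fixed before \<open>\<delta>\<close>, because the Lipschitz
    constant \<open>exp N\<close> grows with it; this is possible since the truncation error is
    uniform in \<open>u\<close>.\<close>
  then obtain N where N: "M * exp (- real N) < \<epsilon> / 4"
    by (auto simp: eventually_sequentially)
  define L where "L = exp (real N) * (real d * R) * V"
  have L: "L \<ge> 0"
    using R V by (simp add: L_def)
  \<comment> \<open>The denominator uses \<open>L + 1\<close> because \<open>L\<close> vanishes when
    \<open>R = 0\<close>.\<close>
  define \<delta> where "\<delta> = \<epsilon> / (2 * (L + 1))"
  have \<delta>: "\<delta> > 0" "L * \<delta> \<le> \<epsilon> / 2"
    using L \<open>\<epsilon> > 0\<close> by (simp_all add: \<delta>_def field_simps)
  note [measurable] = norm_cpairing_measurable polydisc_measurable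
  show ?thesis
  proof (rule that[OF \<delta>(1)])
    fix u v
    assume u: "cnorm d u = 1" and v: "cnorm d v = 1"
      and uv: "\<And>j. j < d \<Longrightarrow> cmod (u j - v j) \<le> \<delta>"
    let ?T = "\<lambda>u a. ereal (trunc_log N (cmod (cpairing d a u)))"
    let ?P = "polydisc d R"
    have T: "e2ennreal \<bar>?T u a - ?T v a\<bar> \<le> ennreal (exp (real N) * (real d * (R * \<delta>)))" if "a \<in> ?P" for a
    proof -
      have "\<bar>cmod (cpairing d a u) - cmod (cpairing d a v)\<bar> \<le> cmod (cpairing d a u - cpairing d a v)"
        by (rule norm_triangle_ineq3)
      also have "cpairing d a u - cpairing d a v = cpairing d a (\<lambda>j. u j - v j)"
        by (simp add: cpairing_def sum_subtractf right_diff_distrib)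
      also have "cmod \<dots> \<le> real d * (R * \<delta>)"
        using that uv by (rule norm_cpairing_polydisc)
      finally have "exp (real N) * \<bar>cmod (cpairing d a u) - cmod (cpairing d a v)\<bar>
          \<le> exp (real N) * (real d * (R * \<delta>))"
        by (intro mult_left_mono) auto
      then have "\<bar>trunc_log N (cmod (cpairing d a u)) - trunc_log N (cmod (cpairing d a v))\<bar>
          \<le> exp (real N) * (real d * (R * \<delta>))"
        using trunc_log_lipschitz order_trans by blast
      then show ?thesis
        by (simp add: ennreal_leI)
    qed
    have "(\<integral>\<^sup>+a\<in>?P. e2ennreal \<bar>log_pairing d u a - log_pairing d v a\<bar> \<partial>clebesgue d)
        \<le> (\<integral>\<^sup>+a\<in>?P. e2ennreal \<bar>log_pairing d u a - ?T u a\<bar> \<partial>clebesgue d)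
          + (\<integral>\<^sup>+a\<in>?P. e2ennreal \<bar>?T u a - log_pairing d v a\<bar> \<partial>clebesgue d)"
      by (intro nn_integral_abs_diff_triangle) measurable
    also have "\<dots> \<le> (\<integral>\<^sup>+a\<in>?P. e2ennreal \<bar>log_pairing d u a - ?T u a\<bar> \<partial>clebesgue d)
          + ((\<integral>\<^sup>+a\<in>?P. e2ennreal \<bar>?T u a - ?T v a\<bar> \<partial>clebesgue d)
            + (\<integral>\<^sup>+a\<in>?P. e2ennreal \<bar>?T v a - log_pairing d v a\<bar> \<partial>clebesgue d))"
      by (intro add_left_mono nn_integral_abs_diff_triangle) measurable
    also have "\<dots> \<le> ennreal (M * exp (- real N))
          + (ennreal (exp (real N) * (real d * (R * \<delta>))) * ennreal V + ennreal (M * exp (- real N)))"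
    proof (intro add_mono)
      show "(\<integral>\<^sup>+a\<in>?P. e2ennreal \<bar>log_pairing d u a - ?T u a\<bar> \<partial>clebesgue d) \<le> ennreal (M * exp (- real N))"
        unfolding M_def by (rule nn_integral_log_minus_trunc_log[OF u R])
      show "(\<integral>\<^sup>+a\<in>?P. e2ennreal \<bar>?T v a - log_pairing d v a\<bar> \<partial>clebesgue d) \<le> ennreal (M * exp (- real N))"
        unfolding M_def ereal_abs_diff_commute[of "?T v _"]
        by (rule nn_integral_log_minus_trunc_log[OF v R])
      show "(\<integral>\<^sup>+a\<in>?P. e2ennreal \<bar>?T u a - ?T v a\<bar> \<partial>clebesgue d)
          \<le> ennreal (exp (real N) * (real d * (R * \<delta>))) * ennreal V"
        unfolding V_def by (rule nn_integral_polydisc_bounded[OF R T])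
    qed
    also have "\<dots> = ennreal (2 * (M * exp (- real N)) + L * \<delta>)"
      using M V R \<delta>(1) by (simp flip: ennreal_mult ennreal_plus add: L_def mult_ac)
    also have "\<dots> \<le> ennreal \<epsilon>"
      using N \<delta>(2) by (intro ennreal_leI) linarith
    finally show "(\<integral>\<^sup>+a\<in>?P. e2ennreal \<bar>log_pairing d u a - log_pairing d v a\<bar> \<partial>clebesgue d) \<le> ennreal \<epsilon>" .
  qed
qed

section \<open>Plurisubharmonicity of \<open>log \<bar>\<langle>a, u\<rangle>\<bar>\<close>\<close>

lemma log_ext_mono: "0 \<le> x \<Longrightarrow> x \<le> y \<Longrightarrow> log_ext x \<le> log_ext y"
  by (auto simp: log_ext_def)

text \<open>At \<open>x = 0\<close> the limit is -\<infinity>, since eventually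
  \<open>X n < exp r\<close> for each real \<open>r\<close>; elsewhere this is continuity of
  \<open>ln\<close>.\<close>

lemma tendsto_log_ext:
  assumes X: "(X \<longlongrightarrow> x) F" and nonneg: "\<And>n. X n \<ge> 0" "x \<ge> 0"
  shows "((\<lambda>n. log_ext (X n)) \<longlongrightarrow> log_ext x) F"
proof (cases "x = 0")
  case True
  have "eventually (\<lambda>n. log_ext (X n) < ereal r) F" for r
  proof -
    have "eventually (\<lambda>n. X n < exp r) F"
      using X True by (intro order_tendstoD) auto
    then show ?thesis
    proof eventually_elim
      case (elim n)
      then show ?case
        using nonneg(1)[of n] ln_less_cancel_iff[of "X n" "exp r"] by (simp add: log_ext_def)
    qed
  qed
  then show ?thesis
    using True by (simp add: log_ext_def tendsto_MInfty)
next
  case False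
  have "eventually (\<lambda>n. 0 < X n) F"
    using X False nonneg by (intro order_tendstoD) auto
  then have "eventually (\<lambda>n. ereal (ln (X n)) = log_ext (X n)) F"
    by eventually_elim (simp add: log_ext_def)
  moreover have "((\<lambda>n. ereal (ln (X n))) \<longlongrightarrow> log_ext x) F"
    using False tendsto_ln[OF X False] by (simp add: log_ext_def)
  ultimately show ?thesis
    by (rule Lim_transform_eventually[rotated])
qed

section \<open>Circle averages of the logarithm of an affine function\<close>

text \<open>With \<open>w = \<beta> / \<alpha>\<close> the integrand is
  \<open>ln (cmod \<alpha>)\<close> plus the real part of \<open>Ln (1 + w * z)\<close> on the unit
  circle. As \<open>cmod w < 1\<close>, \<open>1 + w * z\<close> stays in the right half-plane, so
  the principal branch is holomorphic on the closed disc and Cauchy's formula gives it the mean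
  \<open>Ln 1 = 0\<close>.\<close>

lemma has_integral_ln_norm_affine:
  fixes \<alpha> \<beta> :: complex
  assumes "cmod \<beta> < cmod \<alpha>"
  shows "((\<lambda>t. ln (cmod (\<alpha> + \<beta> * cis (2 * pi * t)))) has_integral ln (cmod \<alpha>)) {0..1}"
proof -
  define w where "w = \<beta> / \<alpha>"
  have \<alpha>: "\<alpha> \<noteq> 0"
    using assms by auto
  have w: "cmod w < 1"
    using assms \<alpha> by (simp add: w_def norm_divide)
  have pos: "Re (1 + w * z) > 0" if "cmod z \<le> 1" for z
  proof -
    have "cmod (w * z) \<le> cmod w * 1"
      unfolding norm_mult using that by (intro mult_left_mono) auto
    then have "\<bar>Re (w * z)\<bar> < 1"
      using w abs_Re_le_cmod[of "w * z"] by linarith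
    moreover have "Re (1 + w * z) = 1 + Re (w * z)"
      by (simp del: times_complex.sel)
    ultimately show ?thesis
      by linarith
  qed
  have "(\<lambda>z. Ln (1 + w * z)) holomorphic_on cball 0 1"
  proof (intro holomorphic_intros)
    fix z :: complex assume "z \<in> cball 0 1"
    then have "Re (1 + w * z) > 0"
      by (intro pos) simp
    then show "1 + w * z \<notin> \<real>\<^sub>\<le>\<^sub>0"
      by (simp only: complex_nonpos_Reals_iff) linarith
  qed
  then have "((\<lambda>z. Ln (1 + w * z) / (z - 0)) has_contour_integral (2 * of_real pi * \<i> * Ln (1 + w * 0)))
      (circlepath 0 1)"
    by (rule Cauchy_integral_circlepath_simple) simp
  then have "((\<lambda>t. Ln (1 + w * circlepath 0 1 t) / circlepath 0 1 t *
      vector_derivative (circlepath 0 1) (at t within {0..1})) has_integral 0) {0..1}"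
    by (simp add: has_contour_integral_def)
  \<comment> \<open>On the circle \<open>z = cis (2 * pi * t)\<close>, the form dz / z becomes the
    constant \<open>2 * pi * \<i>\<close> times dt, which is then divided out.\<close>
  then have "((\<lambda>t. Ln (1 + w * cis (2 * pi * t)) * (2 * of_real pi * \<i>)) has_integral 0) {0..1}"
  proof (rule has_integral_eq[rotated])
    fix t :: real assume t: "t \<in> {0..1}"
    have 1: "circlepath 0 1 t = cis (2 * pi * t)"
      by (simp add: circlepath cis_conv_exp mult_ac)
    have 2: "vector_derivative (circlepath 0 1) (at t within {0..1}) = 2 * of_real pi * \<i> * cis (2 * pi * t)"
      using t by (simp add: vector_derivative_circlepath01 cis_conv_exp mult_ac)
    show "Ln (1 + w * circlepath 0 1 t) / circlepath 0 1 t *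
      vector_derivative (circlepath 0 1) (at t within {0..1})
      = Ln (1 + w * cis (2 * pi * t)) * (2 * of_real pi * \<i>)"
      unfolding 1 2 by simp
  qed
  then have "((\<lambda>t. Ln (1 + w * cis (2 * pi * t)) * (2 * of_real pi * \<i>) * inverse (2 * of_real pi * \<i>))
      has_integral 0 * inverse (2 * of_real pi * \<i>)) {0..1}"
    by (rule has_integral_mult_left)
  moreover have "Ln (1 + w * cis (2 * pi * t)) * (2 * of_real pi * \<i>) * inverse (2 * of_real pi * \<i>)
      = Ln (1 + w * cis (2 * pi * t))" for t
    unfolding mult.assoc[of "Ln _"] by (subst right_inverse) auto
  ultimately have "((\<lambda>t. Ln (1 + w * cis (2 * pi * t))) has_integral 0) {0..1}"
    by (simp only: mult_zero_left)
  from has_integral_linear[OF this bounded_linear_Re]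
  have "((\<lambda>t. Re (Ln (1 + w * cis (2 * pi * t)))) has_integral 0) {0..1}"
    by (simp only: o_def zero_complex.sel)
  moreover have "((\<lambda>_. ln (cmod \<alpha>)) has_integral ln (cmod \<alpha>)) {0..1::real}"
    using has_integral_const_real[of "ln (cmod \<alpha>)" 0 1] by simp
  ultimately have "((\<lambda>t. ln (cmod \<alpha>) + Re (Ln (1 + w * cis (2 * pi * t)))) has_integral ln (cmod \<alpha>) + 0) {0..1}"
    by (intro has_integral_add)
  then have "((\<lambda>t. ln (cmod \<alpha>) + Re (Ln (1 + w * cis (2 * pi * t)))) has_integral ln (cmod \<alpha>)) {0..1}"
    by (simp only: add_0_right)
  then show ?thesis
  proof (rule has_integral_eq[rotated])
    fix t :: real
    have "Re (1 + w * cis (2 * pi * t)) > 0"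
      by (rule pos) simp
    then have nz: "1 + w * cis (2 * pi * t) \<noteq> 0"
      by (intro notI) (simp only: zero_complex.sel)
    have "\<alpha> + \<beta> * cis (2 * pi * t) = \<alpha> * (1 + w * cis (2 * pi * t))"
      using \<alpha> by (simp add: w_def algebra_simps)
    then show "ln (cmod \<alpha>) + Re (Ln (1 + w * cis (2 * pi * t))) = ln (cmod (\<alpha> + \<beta> * cis (2 * pi * t)))"
      using \<alpha> nz by (simp add: norm_mult ln_mult)
  qed
qed

abbreviation unit_interval :: "real measure" where
  "unit_interval \<equiv> restrict_space lborel {0..1}"

text \<open>Reduces a lower bound for a difference of two extended integrals to an upper bound for
  one integral of the nonnegative function \<open>B - f\<close>. Integrating the identity
  \<open>B + f^- = (B - f) + f^+\<close> avoids subtracting infinite quantities.\<close>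

lemma ext_integral_ge:
  assumes [measurable]: "f \<in> borel_measurable M" and "emeasure M (space M) = 1" and "B \<ge> 0"
    and f_le: "\<And>x. f x \<le> ereal B" and "c \<le> B"
    and le: "(\<integral>\<^sup>+x. e2ennreal (ereal B - f x) \<partial>M) \<le> ennreal (B - c)"
  shows "ereal c \<le> ext_integral M f"
proof -
  define P where "P = (\<integral>\<^sup>+x. e2ennreal (f x) \<partial>M)"
  define N where "N = (\<integral>\<^sup>+x. e2ennreal (- f x) \<partial>M)"
  have pw: "ennreal B + e2ennreal (- f x) = e2ennreal (ereal B - f x) + e2ennreal (f x)" for x
  proof (cases "f x")
    case (real r)
    then have "r \<le> B"
      using f_le[of x] by simp
    then show ?thesis
      using real \<open>B \<ge> 0\<close>
      by (cases "r \<ge> 0") (auto simp: ennreal_neg simp flip: ennreal_plus)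
  next
    case PInf
    then show ?thesis
      using f_le[of x] by simp
  next
    case MInf
    then show ?thesis
      by (simp add: e2ennreal_neg)
  qed
  have "ennreal B + N = (\<integral>\<^sup>+x. ennreal B + e2ennreal (- f x) \<partial>M)"
    unfolding N_def using assms(2) by (subst nn_integral_add) auto
  also have "\<dots> = (\<integral>\<^sup>+x. e2ennreal (ereal B - f x) \<partial>M) + P"
    unfolding P_def pw by (intro nn_integral_add) measurable
  also have "\<dots> \<le> ennreal (B - c) + P"
    by (intro add_right_mono le)
  finally have *: "ennreal B + N \<le> ennreal (B - c) + P" .
  have "P \<le> (\<integral>\<^sup>+x. ennreal B \<partial>M)"
    unfolding P_def using e2ennreal_mono[OF f_le] by (intro nn_integral_mono) simp
  also have "\<dots> = ennreal B"
    using assms(2) by simp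
  \<comment> \<open>Finiteness of \<open>P\<close> makes the right-hand side of the preceding
    inequality finite, hence also \<open>N\<close>; only then can the inequality be read in the
    reals.\<close>
  finally have "P \<le> ennreal B" .
  then obtain p where p: "P = ennreal p" "p \<ge> 0"
    by (metis ennreal_cases ennreal_neq_top top_unique)
  have "ennreal B + N \<noteq> \<infinity>"
    using * p by (auto simp: top_unique simp flip: ennreal_plus)
  then obtain n where n: "N = ennreal n" "n \<ge> 0"
    by (cases N rule: ennreal_cases) auto
  have "B + n \<le> (B - c) + p"
    using * p n \<open>B \<ge> 0\<close> \<open>c \<le> B\<close> by (simp flip: ennreal_plus)
  then have "c \<le> p - n"
    by simp
  then show ?thesis
    using p n by (simp add: ext_integral_def flip: P_def N_def)
qed

lemma measurable_log_ext_affine: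
  "(\<lambda>t. log_ext (cmod (\<alpha> + \<beta> * cis (2 * pi * t)))) \<in> borel_measurable lborel"
proof -
  have "continuous_on UNIV (\<lambda>t. cmod (\<alpha> + \<beta> * cis (2 * pi * t)))"
    by (intro continuous_intros)
  then have "(\<lambda>t. cmod (\<alpha> + \<beta> * cis (2 * pi * t))) \<in> borel_measurable borel"
    by (rule borel_measurable_continuous_onI)
  then show ?thesis
    by measurable
qed

lemma log_ext_affine_le:
  "log_ext (cmod (\<alpha> + \<beta> * cis \<theta>)) \<le> ereal (cmod \<alpha> + cmod \<beta>)"
proof -
  have "cmod (\<alpha> + \<beta> * cis \<theta>) \<le> cmod \<alpha> + cmod \<beta>"
    by (metis mult.right_neutral norm_cis norm_mult norm_triangle_ineq)
  moreover have "ln (cmod (\<alpha> + \<beta> * cis \<theta>)) \<le> cmod (\<alpha> + \<beta> * cis \<theta>)" if "cmod (\<alpha> + \<beta> * cis \<theta>) > 0"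
    using ln_le_minus_one[OF that] by linarith
  ultimately show ?thesis
    by (fastforce simp: log_ext_def)
qed

text \<open>The mean value equality carried over to the Lebesgue integral: subtracting from the
  upper bound \<open>B\<close> makes the integrand nonnegative. The strict inequality keeps zeros
  off the circle, so \<open>log_ext\<close> agrees with \<open>ln\<close> there.\<close>

lemma nn_integral_log_ext_affine:
  assumes "cmod \<beta> < cmod \<alpha>" "cmod \<alpha> + cmod \<beta> \<le> B"
  shows "(\<integral>\<^sup>+t. e2ennreal (ereal B - log_ext (cmod (\<alpha> + \<beta> * cis (2 * pi * t)))) \<partial>unit_interval)
    = ennreal (B - ln (cmod \<alpha>))"
proof -
  let ?f = "\<lambda>t. ln (cmod (\<alpha> + \<beta> * cis (2 * pi * t)))"
  have nz: "\<alpha> + \<beta> * cis (2 * pi * t) \<noteq> 0" for t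
  proof
    assume "\<alpha> + \<beta> * cis (2 * pi * t) = 0"
    then have "\<alpha> = - (\<beta> * cis (2 * pi * t))"
      by (simp add: eq_neg_iff_add_eq_0)
    then have "cmod \<alpha> = cmod \<beta>"
      by (simp add: norm_mult)
    then show False
      using assms(1) by simp
  qed
  then have log_ext_eq: "log_ext (cmod (\<alpha> + \<beta> * cis (2 * pi * t))) = ereal (?f t)" for t
    by (simp add: log_ext_def)
  have f_le: "?f t \<le> B" for t
    using log_ext_affine_le[of \<alpha> \<beta> "2 * pi * t"] assms(2) unfolding log_ext_eq by simp
  have meas: "?f \<in> borel_measurable borel"
    using measurable_log_ext_affine[of \<alpha> \<beta>] unfolding log_ext_eq by simp
  define g where "g = (\<lambda>t. if t \<in> {0..1} then B - ?f t else 0)"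
  have "((\<lambda>t. B - ?f t) has_integral B - ln (cmod \<alpha>)) {0..1}"
    using has_integral_const_real[of B 0 1]
    by (intro has_integral_diff has_integral_ln_norm_affine assms(1)) auto
  then have "(g has_integral B - ln (cmod \<alpha>)) UNIV"
    unfolding g_def has_integral_restrict_UNIV .
  moreover have "g \<in> borel_measurable borel"
    unfolding g_def using meas by measurable
  moreover have "0 \<le> g t" for t
    using f_le by (simp add: g_def)
  ultimately have "integral\<^sup>N lborel g = ennreal (B - ln (cmod \<alpha>))"
    by (intro nn_integral_has_integral_lborel)
  moreover have "(\<integral>\<^sup>+t. e2ennreal (ereal B - log_ext (cmod (\<alpha> + \<beta> * cis (2 * pi * t)))) \<partial>unit_interval)
      = integral\<^sup>N lborel g"
    unfolding log_ext_eq
    by (subst nn_integral_restrict_space) (auto simp: g_def indicator_def intro!: nn_integral_cong)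
  ultimately show ?thesis
    by simp
qed

text \<open>On the boundary \<open>\<bar>\<beta>\<bar> = \<bar>\<alpha>\<bar>\<close> the integrand is singular; Fatou's lemma as \<open>r\<beta> \<rightarrow> \<beta>\<close>
  loses only in the harmless direction.\<close>

lemma nn_integral_log_ext_affine_le:
  assumes "\<alpha> \<noteq> 0" "cmod \<beta> \<le> cmod \<alpha>" "cmod \<alpha> + cmod \<beta> \<le> B"
  shows "(\<integral>\<^sup>+t. e2ennreal (ereal B - log_ext (cmod (\<alpha> + \<beta> * cis (2 * pi * t)))) \<partial>unit_interval)
    \<le> ennreal (B - ln (cmod \<alpha>))"
proof -
  \<comment> \<open>The factors lie in \<open>[1/2, 1)\<close>, so each \<open>r n * \<beta>\<close>
    satisfies the strict inequality of the regular case.\<close>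
  define r where "r = (\<lambda>n. 1 - inverse (real (Suc (Suc n))))"
  have r: "0 \<le> r n" "r n < 1" for n
    by (auto simp: r_def field_simps)
  have r_lim: "r \<longlonglongrightarrow> 1"
    unfolding r_def
    using tendsto_diff[OF tendsto_const[of 1] LIMSEQ_Suc[OF LIMSEQ_inverse_real_of_nat]] by simp
  define F where "F = (\<lambda>\<beta> t. e2ennreal (ereal B - log_ext (cmod (\<alpha> + \<beta> * cis (2 * pi * t)))))"
  have F_meas: "F \<gamma> \<in> borel_measurable unit_interval" for \<gamma>
    unfolding F_def using measurable_restrict_space1[OF measurable_log_ext_affine] by measurable
  have F_lim: "(\<lambda>n. F (of_real (r n) * \<beta>) t) \<longlonglongrightarrow> F \<beta> t" for t
  proof -
    have "(\<lambda>n. cmod (\<alpha> + of_real (r n) * \<beta> * cis (2 * pi * t))) \<longlonglongrightarrow> cmod (\<alpha> + of_real 1 * \<beta> * cis (2 * pi * t))"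
      by (intro tendsto_intros r_lim)
    then have "(\<lambda>n. log_ext (cmod (\<alpha> + of_real (r n) * \<beta> * cis (2 * pi * t))))
        \<longlonglongrightarrow> log_ext (cmod (\<alpha> + \<beta> * cis (2 * pi * t)))"
      by (intro tendsto_log_ext) auto
    then have "(\<lambda>n. ereal B - log_ext (cmod (\<alpha> + of_real (r n) * \<beta> * cis (2 * pi * t))))
        \<longlonglongrightarrow> ereal B - log_ext (cmod (\<alpha> + \<beta> * cis (2 * pi * t)))"
      by (intro tendsto_diff_ereal_general tendsto_const) auto
    then show ?thesis
      unfolding F_def by (rule tendsto_e2ennrealI)
  qed
  have "(\<integral>\<^sup>+t. F \<beta> t \<partial>unit_interval) = (\<integral>\<^sup>+t. liminf (\<lambda>n. F (of_real (r n) * \<beta>) t) \<partial>unit_interval)"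
    using lim_imp_Liminf[OF _ F_lim] by simp
  also have "\<dots> \<le> liminf (\<lambda>n. \<integral>\<^sup>+t. F (of_real (r n) * \<beta>) t \<partial>unit_interval)"
    by (intro nn_integral_liminf F_meas)
  also have "\<dots> = liminf (\<lambda>n. ennreal (B - ln (cmod \<alpha>)))"
  proof -
    have "(\<integral>\<^sup>+t. F (of_real (r n) * \<beta>) t \<partial>unit_interval) = ennreal (B - ln (cmod \<alpha>))" for n
      unfolding F_def
    proof (rule nn_integral_log_ext_affine)
      have "cmod (of_real (r n) * \<beta>) \<le> r n * cmod \<alpha>"
        using r assms by (simp add: norm_mult mult_left_mono)
      also have "\<dots> < 1 * cmod \<alpha>"
        using r assms by (intro mult_strict_right_mono) auto
      finally show "cmod (of_real (r n) * \<beta>) < cmod \<alpha>"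
        by simp
      have "cmod (of_real (r n) * \<beta>) \<le> 1 * cmod \<beta>"
        using r[of n] by (simp add: norm_mult mult_left_le_one_le)
      then show "cmod \<alpha> + cmod (of_real (r n) * \<beta>) \<le> B"
        using assms by simp
    qed
    then show ?thesis
      by simp
  qed
  finally show ?thesis
    by (simp add: F_def Liminf_const)
qed

text \<open>Conjugation and multiplication by the unit number \<open>cis \<theta>\<close> preserve
  the modulus. The effect is to exchange the roles of \<open>\<alpha>\<close> and
  \<open>\<beta>\<close> on the circle.\<close>

lemma norm_add_cis_flip: "cmod (\<alpha> + \<beta> * cis \<theta>) = cmod (cnj \<beta> + cnj \<alpha> * cis \<theta>)"
proof -
  have "cmod (\<alpha> + \<beta> * cis \<theta>) = cmod (cnj (\<alpha> + \<beta> * cis \<theta>))"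
    by (rule complex_mod_cnj[symmetric])
  also have "\<dots> = cmod (cnj (\<alpha> + \<beta> * cis \<theta>) * cis \<theta>)"
    by (simp add: norm_mult)
  also have "cnj (\<alpha> + \<beta> * cis \<theta>) * cis \<theta> = cnj \<beta> + cnj \<alpha> * cis \<theta>"
    by (simp add: distrib_right cis_cnj mult.assoc cis_mult)
  finally show ?thesis .
qed

text \<open>If \<open>cmod \<beta> \<le> cmod \<alpha>\<close>, the preceding integral bound
  applies, the case \<open>\<alpha> = 0\<close> being trivial. Otherwise the flip gives the mean the
  lower bound \<open>log_ext (cmod \<beta>)\<close>, which dominates
  \<open>log_ext (cmod \<alpha>)\<close>.\<close>

lemma log_ext_affine_submean:
  "log_ext (cmod \<alpha>) \<le> ext_integral unit_interval (\<lambda>t. log_ext (cmod (\<alpha> + \<beta> * cis (2 * pi * t))))"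
proof -
  have *: "log_ext (cmod \<alpha>) \<le> ext_integral unit_interval (\<lambda>t. log_ext (cmod (\<alpha> + \<beta> * cis (2 * pi * t))))"
    if "cmod \<beta> \<le> cmod \<alpha>" for \<alpha> \<beta>
  proof (cases "\<alpha> = 0")
    case True
    then show ?thesis
      by (simp add: log_ext_def)
  next
    case False
    have "ereal (ln (cmod \<alpha>)) \<le> ext_integral unit_interval (\<lambda>t. log_ext (cmod (\<alpha> + \<beta> * cis (2 * pi * t))))"
    proof (rule ext_integral_ge[where B = "cmod \<alpha> + cmod \<beta>"])
      show "emeasure unit_interval (space unit_interval) = 1"
        by (simp add: emeasure_restrict_space space_restrict_space)
      show "ln (cmod \<alpha>) \<le> cmod \<alpha> + cmod \<beta>"
        using ln_le_minus_one[of "cmod \<alpha>", unfolded zero_less_norm_iff, OF False] norm_ge_zero[of \<beta>]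
        by linarith
      show "log_ext (cmod (\<alpha> + \<beta> * cis (2 * pi * t))) \<le> ereal (cmod \<alpha> + cmod \<beta>)" for t
        by (rule log_ext_affine_le)
      show "(\<lambda>t. log_ext (cmod (\<alpha> + \<beta> * cis (2 * pi * t)))) \<in> borel_measurable unit_interval"
        by (intro measurable_restrict_space1 measurable_log_ext_affine)
      show "(\<integral>\<^sup>+t. e2ennreal (ereal (cmod \<alpha> + cmod \<beta>) - log_ext (cmod (\<alpha> + \<beta> * cis (2 * pi * t)))) \<partial>unit_interval)
          \<le> ennreal (cmod \<alpha> + cmod \<beta> - ln (cmod \<alpha>))"
        by (rule nn_integral_log_ext_affine_le[OF False that order_refl])
    qed simp
    then show ?thesis
      using False by (simp add: log_ext_def)
  qed
  show ?thesis
  proof (cases "cmod \<beta> \<le> cmod \<alpha>")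
    case True
    then show ?thesis
      by (rule *)
  next
    case False
    have "log_ext (cmod \<alpha>) \<le> log_ext (cmod (cnj \<beta>))"
      using False by (intro log_ext_mono) auto
    also have "\<dots> \<le> ext_integral unit_interval (\<lambda>t. log_ext (cmod (cnj \<beta> + cnj \<alpha> * cis (2 * pi * t))))"
      using False by (intro *) auto
    finally show ?thesis
      unfolding norm_add_cis_flip[of \<alpha> \<beta>] .
  qed
qed

text \<open>On a complex line the pairing is affine in \<open>z\<close>, with constant term
  \<open>cpairing d a u\<close> and slope \<open>cpairing d b u\<close>, so the one-variable
  inequality applies. Semicontinuity holds because sublevel sets are preimages of
  \<open>{..<exp r}\<close>, zeros of the pairing included.\<close>

lemma psh_on_log_pairing: "psh_on d (cspace d) (log_pairing d u)"
  unfolding psh_on_def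
proof (intro conjI ballI allI impI)
  fix a
  show "log_pairing d u a < \<infinity>"
    by (simp add: log_pairing_def log_ext_def)
next
  fix c :: ereal
  show "openin (ctop d) {a \<in> cspace d. log_pairing d u a < c}"
  proof (cases c)
    case (real r)
    have "{a \<in> cspace d. log_pairing d u a < c} = {a \<in> topspace (ctop d). cmod (cpairing d a u) \<in> {..<exp r}}"
      using real ln_less_cancel_iff[of _ "exp r"] by (auto simp: log_pairing_def log_ext_def)
    then show ?thesis
      using openin_continuous_map_preimage[OF continuous_map_norm_cpairing, of "{..<exp r}"] by simp
  next
    case PInf
    then have "{a \<in> cspace d. log_pairing d u a < c} = topspace (ctop d)"
      by (auto simp: log_pairing_def log_ext_def)
    then show ?thesis
      by (metis openin_topspace)
  qed simp
next
  fix a b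
  have "cpairing d (cline d a b z) u = cpairing d a u + cpairing d b u * z" for z
    by (simp add: cpairing_def cline_def sum.distrib sum_distrib_left algebra_simps)
  then show "log_pairing d u a \<le> ext_integral (restrict_space lborel {0..1})
      (\<lambda>t. log_pairing d u (cline d a b (cis (2 * pi * t))))"
    unfolding log_pairing_def using log_ext_affine_submean by simp
qed

section \<open>Compactness of the family and the integral estimate\<close>

lemma openin_ctop_box:
  assumes "\<delta> > 0"
  shows "openin (ctop d) {v \<in> cspace d. \<forall>j<d. cmod (u j - v j) < \<delta>}"
proof -
  have "{v \<in> cspace d. \<forall>j<d. cmod (u j - v j) < \<delta>} = (\<Pi>\<^sub>E j\<in>{..<d}. ball (u j) \<delta>)"
    unfolding cspace_def PiE_iff mem_ball dist_norm set_eq_iff mem_Collect_eq by blast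
  then show ?thesis
    by (simp add: ctop_def openin_PiE_gen)
qed

text \<open>The sphere is closed, as a level set of the continuous \<open>cnorm d\<close>, and lies
  in the compact unit polydisc.\<close>

lemma compactin_unit_sphere: "compactin (ctop d) {u \<in> cspace d. cnorm d u = 1}"
proof (rule closed_compactin[OF compactin_polydisc])
  show "{u \<in> cspace d. cnorm d u = 1} \<subseteq> polydisc d 1"
  proof
    fix u assume u: "u \<in> {u \<in> cspace d. cnorm d u = 1}"
    then have "cmod (u j) \<le> 1" if "j < d" for j
      using cnorm_component_le[OF that, of u] by simp
    then show "u \<in> polydisc d 1"
      using u by (simp add: cspace_def polydisc_def PiE_iff)
  qed
  show "closedin (ctop d) {u \<in> cspace d. cnorm d u = 1}"
    using closedin_continuous_map_preimage[OF continuous_map_cnorm, of "{1}"] by simp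
qed

text \<open>The continuity of \<open>log_pairing d\<close> on the sphere, tested on a subbasic ball
  around an arbitrary \<open>f\<close>: by uniform continuity and the triangle inequality, a box
  around \<open>u\<close> stays in the preimage.\<close>

lemma openin_L1loc_ball_preimage:
  assumes f: "f \<in> L1loc d (cspace d)" and K: "compactin (ctop d) K"
  shows "openin (subtopology (ctop d) {u \<in> cspace d. cnorm d u = 1})
    {u \<in> cspace d. cnorm d u = 1 \<and>
      (\<integral>\<^sup>+a\<in>K. e2ennreal \<bar>log_pairing d u a - f a\<bar> \<partial>clebesgue d) < ennreal \<epsilon>}"
    (is "openin _ ?W")
proof (subst openin_subopen, rule ballI)
  fix u assume "u \<in> ?W"
  then have u: "u \<in> cspace d" "cnorm d u = 1"
    and less: "(\<integral>\<^sup>+a\<in>K. e2ennreal \<bar>log_pairing d u a - f a\<bar> \<partial>clebesgue d) < ennreal \<epsilon>"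
    by auto
  have Kmeas: "K \<in> sets (clebesgue d)"
    using compactin_imp_closedin[OF Hausdorff_ctop K] closedin_ctop_cborel sets_cborel_subset_clebesgue
    by blast
  have fmeas: "f \<in> borel_measurable (clebesgue d)"
  proof -
    have "sets (restrict_space (clebesgue d) (cspace d)) = sets (clebesgue d)"
    proof -
      have "(\<inter>) (cspace d) ` sets (clebesgue d) = (\<lambda>A. A) ` sets (clebesgue d)"
        by (intro image_cong refl) (metis sets.Int_space_eq1 space_clebesgue)
      then show ?thesis
        by (simp only: sets_restrict_space image_ident)
    qed
    then show ?thesis
      using f by (simp add: L1loc_def cong: measurable_cong_sets)
  qed
  obtain R where R: "R \<ge> 0" "K \<subseteq> polydisc d R"
    using compactin_imp_polydisc K by blast
  obtain e where e: "e \<ge> 0" "(\<integral>\<^sup>+a\<in>K. e2ennreal \<bar>log_pairing d u a - f a\<bar> \<partial>clebesgue d) = ennreal e"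
    using less by (cases "\<integral>\<^sup>+a\<in>K. e2ennreal \<bar>log_pairing d u a - f a\<bar> \<partial>clebesgue d" rule: ennreal_cases) auto
  then have "e < \<epsilon>"
    using less by (simp add: ennreal_less_iff)
  \<comment> \<open>Half of the slack at \<open>u\<close> is spent on moving to \<open>v\<close>, so
    the total \<open>(\<epsilon> - e) / 2 + e\<close> is still strictly below
    \<open>\<epsilon>\<close>.\<close>
  then have "(\<epsilon> - e) / 2 > 0"
    by (simp only: half_gt_zero_iff diff_gt_0_iff_gt)
  obtain \<delta> where \<delta>: "\<delta> > 0"
    "\<And>u v. cnorm d u = 1 \<Longrightarrow> cnorm d v = 1 \<Longrightarrow> (\<And>j. j < d \<Longrightarrow> cmod (u j - v j) \<le> \<delta>) \<Longrightarrow>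
      (\<integral>\<^sup>+a\<in>polydisc d R. e2ennreal \<bar>log_pairing d u a - log_pairing d v a\<bar> \<partial>clebesgue d)
        \<le> ennreal ((\<epsilon> - e) / 2)"
    by (rule log_pairing_L1_uniformly_continuous[OF R(1) \<open>(\<epsilon> - e) / 2 > 0\<close>]) blast
  define B where "B = {v \<in> cspace d. \<forall>j<d. cmod (u j - v j) < \<delta>}"
  have "{u \<in> cspace d. cnorm d u = 1} \<inter> B \<subseteq> ?W"
  proof
    fix v assume "v \<in> {u \<in> cspace d. cnorm d u = 1} \<inter> B"
    then have v: "v \<in> cspace d" "cnorm d v = 1" "\<And>j. j < d \<Longrightarrow> cmod (v j - u j) \<le> \<delta>"
      by (auto simp: B_def norm_minus_commute less_imp_le)
    have "(\<integral>\<^sup>+a\<in>K. e2ennreal \<bar>log_pairing d v a - f a\<bar> \<partial>clebesgue d)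
        \<le> (\<integral>\<^sup>+a\<in>K. e2ennreal \<bar>log_pairing d v a - log_pairing d u a\<bar> \<partial>clebesgue d)
          + (\<integral>\<^sup>+a\<in>K. e2ennreal \<bar>log_pairing d u a - f a\<bar> \<partial>clebesgue d)"
      using Kmeas fmeas by (intro nn_integral_abs_diff_triangle log_pairing_measurable)
    also have "(\<integral>\<^sup>+a\<in>K. e2ennreal \<bar>log_pairing d v a - log_pairing d u a\<bar> \<partial>clebesgue d)
        \<le> (\<integral>\<^sup>+a\<in>polydisc d R. e2ennreal \<bar>log_pairing d v a - log_pairing d u a\<bar> \<partial>clebesgue d)"
      using R by (intro nn_integral_mono) (auto simp: indicator_def)
    also have "\<dots> \<le> ennreal ((\<epsilon> - e) / 2)"
      using v u by (intro \<delta>(2)) auto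
    also have "ennreal ((\<epsilon> - e) / 2) + (\<integral>\<^sup>+a\<in>K. e2ennreal \<bar>log_pairing d u a - f a\<bar> \<partial>clebesgue d)
        = ennreal ((\<epsilon> - e) / 2 + e)"
      using e \<open>e < \<epsilon>\<close> by simp
    also have "\<dots> < ennreal \<epsilon>"
      using e(1) \<open>e < \<epsilon>\<close> by (intro ennreal_lessI) (simp_all add: field_simps)
    finally show "v \<in> ?W"
      using v by (simp add: add_right_mono)
  qed
  moreover have "openin (subtopology (ctop d) {u \<in> cspace d. cnorm d u = 1})
      ({u \<in> cspace d. cnorm d u = 1} \<inter> B)"
    unfolding B_def by (intro openin_subtopology_Int2 openin_ctop_box \<delta>(1))
  moreover have "u \<in> {u \<in> cspace d. cnorm d u = 1} \<inter> B"
    using u \<delta>(1) by (simp add: B_def)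
  ultimately show "\<exists>T. openin (subtopology (ctop d) {u \<in> cspace d. cnorm d u = 1}) T \<and> u \<in> T \<and> T \<subseteq> ?W"
    by blast
qed

lemma compactin_log_pairing:
  "compactin (L1loc_topology d (cspace d)) (log_pairing d ` {u \<in> cspace d. cnorm d u = 1})"
proof (rule image_compactin)
  let ?S = "{u \<in> cspace d. cnorm d u = 1}"
  show "compactin (subtopology (ctop d) ?S) ?S"
    by (simp add: compactin_subtopology compactin_unit_sphere)
  show "continuous_map (subtopology (ctop d) ?S) (L1loc_topology d (cspace d)) (log_pairing d)"
    unfolding L1loc_topology_def
  proof (rule continuous_on_generated_topo)
    fix W
    assume "W \<in> {{g \<in> L1loc d (cspace d). (\<integral>\<^sup>+x\<in>K. e2ennreal \<bar>g x - f x\<bar> \<partial>clebesgue d) < ennreal \<epsilon>} | f K \<epsilon>.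
        f \<in> L1loc d (cspace d) \<and> compactin (ctop d) K \<and> K \<subseteq> cspace d \<and> \<epsilon> > 0}"
    then obtain f K \<epsilon> where W: "f \<in> L1loc d (cspace d)" "compactin (ctop d) K"
      "W = {g \<in> L1loc d (cspace d). (\<integral>\<^sup>+x\<in>K. e2ennreal \<bar>g x - f x\<bar> \<partial>clebesgue d) < ennreal \<epsilon>}"
      by blast
    have "log_pairing d -` W \<inter> topspace (subtopology (ctop d) ?S)
        = {u \<in> cspace d. cnorm d u = 1 \<and>
            (\<integral>\<^sup>+a\<in>K. e2ennreal \<bar>log_pairing d u a - f a\<bar> \<partial>clebesgue d) < ennreal \<epsilon>}"
      unfolding W(3) using log_pairing_L1loc by auto
    then show "openin (subtopology (ctop d) ?S) (log_pairing d -` W \<inter> topspace (subtopology (ctop d) ?S))"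
      using openin_L1loc_ball_preimage[OF W(1,2)] by simp
  next
    show "log_pairing d ` topspace (subtopology (ctop d) ?S)
      \<subseteq> \<Union>{{g \<in> L1loc d (cspace d). (\<integral>\<^sup>+x\<in>K. e2ennreal \<bar>g x - f x\<bar> \<partial>clebesgue d) < ennreal \<epsilon>} | f K \<epsilon>.
        f \<in> L1loc d (cspace d) \<and> compactin (ctop d) K \<and> K \<subseteq> cspace d \<and> \<epsilon> > 0}"
    proof
      fix g assume "g \<in> log_pairing d ` topspace (subtopology (ctop d) ?S)"
      then have g: "g \<in> L1loc d (cspace d)"
        using log_pairing_L1loc by auto
      \<comment> \<open>With \<open>K\<close> empty the seminorm vanishes, so this subbasic set is
        all of \<open>L1loc\<close>; hence the generators cover the image.\<close>
      define W where "W = {h \<in> L1loc d (cspace d). (\<integral>\<^sup>+x\<in>{}. e2ennreal \<bar>h x - g x\<bar> \<partial>clebesgue d) < ennreal 1}"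
      have "g \<in> W"
        using g by (simp add: W_def)
      moreover have "W \<in> {{g \<in> L1loc d (cspace d). (\<integral>\<^sup>+x\<in>K. e2ennreal \<bar>g x - f x\<bar> \<partial>clebesgue d) < ennreal \<epsilon>} | f K \<epsilon>.
        f \<in> L1loc d (cspace d) \<and> compactin (ctop d) K \<and> K \<subseteq> cspace d \<and> \<epsilon> > 0}"
        unfolding W_def using g by (intro CollectI exI[of _ g] exI[of _ "{}"] exI[of _ 1]) simp
      ultimately show "g \<in> \<Union>{{g \<in> L1loc d (cspace d). (\<integral>\<^sup>+x\<in>K. e2ennreal \<bar>g x - f x\<bar> \<partial>clebesgue d) < ennreal \<epsilon>} | f K \<epsilon>.
        f \<in> L1loc d (cspace d) \<and> compactin (ctop d) K \<and> K \<subseteq> cspace d \<and> \<epsilon> > 0}"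
        by blast
    qed
  qed
qed

section \<open>From exponential integrability to logarithmic moments\<close>

text \<open>The exponential term controls the singularity for \<open>t \<le> 1\<close>, and the
  constant \<open>ln M powr \<nu>\<close> controls \<open>1 < t \<le> M\<close>.\<close>

lemma powr_ext_abs_log_ext_le:
  assumes \<alpha>: "\<alpha> > 0" and \<nu>: "\<nu> > 0" and t: "0 \<le> t" "t \<le> M" and M: "M \<ge> 1"
  shows "powr_ext \<bar>log_ext t\<bar> \<nu>
    \<le> ennreal ((\<nu> / \<alpha>) powr \<nu>) * exp_ext (- (ereal \<alpha> * log_ext t)) + ennreal (ln M powr \<nu>)"
proof (cases "t = 0")
  case True
  \<comment> \<open>A zero factor would give \<open>0 * \<infinity> = 0\<close> in
    \<open>ennreal\<close>; a nonzero one makes the right-hand side infinite at t = 0.\<close>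
  have "ennreal ((\<nu> / \<alpha>) powr \<nu>) \<noteq> 0"
    using \<alpha> \<nu> by simp
  then show ?thesis
    using True \<alpha> by (simp add: log_ext_def exp_ext_def ennreal_mult_top)
next
  case False
  define x where "x = - ln t"
  have "\<bar>x\<bar> powr \<nu> \<le> (\<nu> / \<alpha>) powr \<nu> * exp (\<alpha> * x) + ln M powr \<nu>"
  proof (cases "x \<ge> 0")
    case True
    \<comment> \<open>The inequality \<open>y \<le> exp y\<close> is used at
      \<open>y = \<alpha> * x / \<nu>\<close>, whose exponential has \<open>\<nu>\<close>-th power
      exactly \<open>exp (\<alpha> * x)\<close>.\<close>
    have "x = \<nu> / \<alpha> * (\<alpha> * x / \<nu>)"
      using \<alpha> \<nu> by simp
    also have "\<dots> \<le> \<nu> / \<alpha> * exp (\<alpha> * x / \<nu>)"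
      using \<alpha> \<nu> exp_ge_add_one_self[of "\<alpha> * x / \<nu>"] by (intro mult_left_mono) (linarith, simp)
    finally have "x powr \<nu> \<le> (\<nu> / \<alpha> * exp (\<alpha> * x / \<nu>)) powr \<nu>"
      using True \<nu> by (intro powr_mono2) auto
    also have "\<dots> = (\<nu> / \<alpha>) powr \<nu> * exp (\<alpha> * x)"
      using \<alpha> \<nu> by (subst powr_mult) (auto simp: exp_powr_real)
    also have "\<dots> \<le> (\<nu> / \<alpha>) powr \<nu> * exp (\<alpha> * x) + ln M powr \<nu>"
      by simp
    finally show ?thesis
      using True by simp
  next
    case neg: False
    have "ln t \<le> ln M"
      using False t M by simp
    then have "\<bar>x\<bar> powr \<nu> \<le> ln M powr \<nu>"
      using neg \<nu> by (intro powr_mono2) (auto simp: x_def)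
    then show ?thesis
      by (simp add: add_increasing)
  qed
  then have "ennreal (\<bar>x\<bar> powr \<nu>) \<le> ennreal ((\<nu> / \<alpha>) powr \<nu> * exp (\<alpha> * x) + ln M powr \<nu>)"
    by (rule ennreal_leI)
  also have "\<dots> = ennreal ((\<nu> / \<alpha>) powr \<nu>) * ennreal (exp (\<alpha> * x)) + ennreal (ln M powr \<nu>)"
    by (simp add: ennreal_mult)
  finally show ?thesis
    using False by (simp add: log_ext_def powr_ext_def exp_ext_def x_def)
qed

text \<open>Local moderateness is applied on the whole space, with the support as compact set and
  the image of the sphere as family. Its constants \<open>c\<close> and \<open>\<alpha>\<close> are
  common to all \<open>u\<close>, and the pointwise bound is then integrated.\<close>

lemma locally_moderate_log_moment:
  assumes "prob_space \<sigma>" and lm: "locally_moderate d \<sigma>"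
    and supp: "compactin (ctop d) (csupport d \<sigma>)" and \<nu>: "\<nu> > 0"
  obtains C where "C > 0"
    "\<And>u. u \<in> cspace d \<Longrightarrow> cnorm d u = 1 \<Longrightarrow>
      (\<integral>\<^sup>+a. powr_ext \<bar>log_ext (cmod (cpairing d a u))\<bar> \<nu> \<partial>\<sigma>) \<le> ennreal C"
proof -
  interpret prob_space \<sigma> by fact
  let ?K = "csupport d \<sigma>"
  let ?S = "{u \<in> cspace d. cnorm d u = 1}"
  have sets_\<sigma>: "sets \<sigma> = sets (cborel d)"
    using lm unfolding locally_moderate_def by (rule conjunct1)
  have "\<exists>c \<alpha>. c > 0 \<and> \<alpha> > 0 \<and>
      (\<forall>\<psi>\<in>log_pairing d ` ?S. (\<integral>\<^sup>+a\<in>?K. exp_ext (- (ereal \<alpha> * \<psi> a)) \<partial>\<sigma>) \<le> ennreal c)"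
  proof (rule lm[unfolded locally_moderate_def, THEN conjunct2, rule_format], intro conjI ballI)
    show "openin (ctop d) (cspace d)"
      by (metis openin_topspace topspace_ctop)
    show "compactin (ctop d) ?K"
      by (rule supp)
    show "?K \<subseteq> cspace d"
      by (auto simp: csupport_def)
    show "compactin (L1loc_topology d (cspace d)) (log_pairing d ` ?S)"
      by (rule compactin_log_pairing)
    show "psh_on d (cspace d) \<psi>" if "\<psi> \<in> log_pairing d ` ?S" for \<psi>
      using that psh_on_log_pairing by blast
  qed
  then obtain c \<alpha> where c: "c > 0" "\<alpha> > 0"
    "\<And>u. u \<in> ?S \<Longrightarrow> (\<integral>\<^sup>+a\<in>?K. exp_ext (- (ereal \<alpha> * log_pairing d u a)) \<partial>\<sigma>) \<le> ennreal c"
    by (elim exE conjE) (rule that, assumption, assumption, erule bspec, erule imageI)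
  obtain R where R: "R \<ge> 0" "?K \<subseteq> polydisc d R"
    using compactin_imp_polydisc supp by blast
  \<comment> \<open>On the support \<open>d * R\<close> bounds the pairing with every unit vector;
    adding 1 ensures \<open>M \<ge> 1\<close>.\<close>
  define M where "M = real d * R + 1"
  have M: "M \<ge> 1"
    using R by (simp add: M_def)
  define A where "A = (\<nu> / \<alpha>) powr \<nu>"
  define B where "B = ln M powr \<nu>"
  have nonneg: "A \<ge> 0" "B \<ge> 0"
    by (simp_all add: A_def B_def)
  have K: "?K \<in> sets \<sigma>"
    unfolding sets_\<sigma> using compactin_imp_closedin[OF Hausdorff_ctop supp] by (rule closedin_ctop_cborel)
  show ?thesis
  proof (rule that)
    show "A * c + B + 1 > 0"
      using nonneg c by (smt (verit) mult_nonneg_nonneg)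
  next
    fix u assume u: "u \<in> cspace d" "cnorm d u = 1"
    let ?E = "\<lambda>a. exp_ext (- (ereal \<alpha> * log_pairing d u a))"
    \<comment> \<open>Measurability is read off the explicit form of this function, a negative power
      of \<open>t\<close> with value \<infinity> at t = 0.\<close>
    have exp_ext_meas: "(\<lambda>t. exp_ext (- (ereal \<alpha> * log_ext t))) \<in> borel_measurable borel"
    proof -
      have "(\<lambda>t. if t = 0 then \<infinity> else ennreal (exp (- (\<alpha> * ln t)))) \<in> borel_measurable borel"
        by measurable
      moreover have "(\<lambda>t. exp_ext (- (ereal \<alpha> * log_ext t)))
          = (\<lambda>t. if t = 0 then \<infinity> else ennreal (exp (- (\<alpha> * ln t))))"
        using c by (auto simp: log_ext_def exp_ext_def)
      ultimately show ?thesis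
        by simp
    qed
    have "(\<lambda>a. cmod (cpairing d a u)) \<in> borel_measurable \<sigma>"
      using continuous_map_imp_cborel_measurable[OF continuous_map_norm_cpairing]
      by (simp cong: measurable_cong_sets[OF sets_\<sigma> refl])
    then have E: "?E \<in> borel_measurable \<sigma>"
      unfolding log_pairing_def using exp_ext_meas by measurable
    have "(\<integral>\<^sup>+a. powr_ext \<bar>log_ext (cmod (cpairing d a u))\<bar> \<nu> \<partial>\<sigma>)
        \<le> (\<integral>\<^sup>+a. ennreal A * (?E a * indicator ?K a) + ennreal B \<partial>\<sigma>)"
    proof (rule nn_integral_mono_AE)
      \<comment> \<open>Almost every point lies in the support, so the indicator of
        \<open>?K\<close> can be inserted; this passes from the whole space to the compact set of
        the moderateness bound.\<close>
      show "AE a in \<sigma>. powr_ext \<bar>log_ext (cmod (cpairing d a u))\<bar> \<nu>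
          \<le> ennreal A * (?E a * indicator ?K a) + ennreal B"
        using AE_in_csupport[OF sets_\<sigma>]
      proof eventually_elim
        case (elim a)
        have "cmod (cpairing d a u) \<le> real d * (R * 1)"
          using elim R u cnorm_component_le by (intro norm_cpairing_polydisc) (blast, metis)
        then have "cmod (cpairing d a u) \<le> M"
          by (simp add: M_def)
        then show ?case
          using elim powr_ext_abs_log_ext_le[OF c(2) \<nu> norm_ge_zero _ M]
          by (simp add: A_def B_def log_pairing_def)
      qed
    qed
    also have "\<dots> = ennreal A * (\<integral>\<^sup>+a\<in>?K. ?E a \<partial>\<sigma>) + ennreal B"
      using E K by (simp add: nn_integral_add nn_integral_cmult emeasure_space_1)
    also have "\<dots> \<le> ennreal A * ennreal c + ennreal B"
      using u by (intro add_right_mono mult_left_mono c(3)) simp_all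
    also have "\<dots> = ennreal (A * c + B)"
      using nonneg c by (simp add: ennreal_mult)
    also have "\<dots> \<le> ennreal (A * c + B + 1)"
      by (intro ennreal_leI) simp
    finally show "(\<integral>\<^sup>+a. powr_ext \<bar>log_ext (cmod (cpairing d a u))\<bar> \<nu> \<partial>\<sigma>) \<le> ennreal (A * c + B + 1)" .
  qed
qed

theorem lemma4p16:
  fixes d :: "nat \<Rightarrow> nat" and \<sigma> :: "nat \<Rightarrow> (nat \<Rightarrow> complex) measure"
  assumes "\<And>p. p \<ge> 1 \<Longrightarrow> d p \<ge> 1"
    and "\<And>p. p \<ge> 1 \<Longrightarrow> prob_space (\<sigma> p)"
    and "\<And>p. p \<ge> 1 \<Longrightarrow> locally_moderate (d p) (\<sigma> p)"
    and "\<And>p. p \<ge> 1 \<Longrightarrow> compactin (ctop (d p)) (csupport (d p) (\<sigma> p))"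
  shows "\<forall>\<nu>::real. \<nu> \<ge> 1 \<longrightarrow> (\<exists>C :: nat \<Rightarrow> real. \<forall>p\<ge>1. C p > 0 \<and>
           (\<forall>u\<in>cspace (d p). cnorm (d p) u = 1 \<longrightarrow>
              (\<integral>\<^sup>+a. powr_ext \<bar>log_ext (cmod (cpairing (d p) a u))\<bar> \<nu> \<partial>\<sigma> p) \<le> ennreal (C p)))"
proof (intro allI impI)
  fix \<nu> :: real assume "\<nu> \<ge> 1"
  then have \<nu>: "\<nu> > 0"
    by simp
  have "\<exists>C. C > 0 \<and> (\<forall>u\<in>cspace (d p). cnorm (d p) u = 1 \<longrightarrow>
      (\<integral>\<^sup>+a. powr_ext \<bar>log_ext (cmod (cpairing (d p) a u))\<bar> \<nu> \<partial>\<sigma> p) \<le> ennreal C)" if "p \<ge> 1" for p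
    by (rule locally_moderate_log_moment[OF assms(2-4)[OF that] \<nu>]) blast
  \<comment> \<open>The constants obtained separately for each \<open>p\<close> are collected into a
    function by the axiom of choice.\<close>
  then show "\<exists>C :: nat \<Rightarrow> real. \<forall>p\<ge>1. C p > 0 \<and>
      (\<forall>u\<in>cspace (d p). cnorm (d p) u = 1 \<longrightarrow>
        (\<integral>\<^sup>+a. powr_ext \<bar>log_ext (cmod (cpairing (d p) a u))\<bar> \<nu> \<partial>\<sigma> p) \<le> ennreal (C p))"
    by (intro choice_iff'[THEN iffD1] allI impI)
qed

end
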